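(* For any integer $k\geq 2$, $$\frac{1}{\sqrt{k-1}}\geq f_{k}^{\ast}>\frac{1}{\sqrt{k-1}+1}=\frac{1}{\sqrt{k-1}}+O\left(k^{-1}\right),$$ where the $O$-term is as $k\to\infty$.
   Context: Graphs are finite, simple and undirected; $v(G)$ is the order (number of vertices) of $G$, and $\overline{G}$ is the complement of $G$. For a graph $G$, $\lambda_i^{\ast}(G)$ denotes the $i$'th largest singular value of its adjacency matrix, i.e. the $i$'th largest of the absolute values of its adjacency eigenvalues (with multiplicity). For $n\ge k\ge1$ let $f_{k}^{\ast}(n)=\max_{v(G)=n}\big(\lambda_{k}^{\ast}(G)+\lambda_{k}^{\ast}(\overline{G})\big)$, and let $f_{k}^{\ast}=\lim_{n\to\infty}f_{k}^{\ast}(n)/n$ (this limit exists). *)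

theory Defs
  imports
    Complex_Main
    "HOL-Library.Landau_Symbols"
    "Jordan_Normal_Form.Char_Poly"
begin

text \<open>
  A finite simple graph of order \<open>n\<close> is represented on the vertex set \<open>{..<n}\<close> by its set of edges,
  a set of two-element sets of vertices.  All quantities below are invariant under isomorphism,
  so fixing the vertex set loses nothing.
\<close>

definition all_pairs :: "nat \<Rightarrow> nat set set" where
  "all_pairs n = {e. e \<subseteq> {..<n} \<and> card e = 2}"

definition graphs_of_order :: "nat \<Rightarrow> nat set set set" where
  "graphs_of_order n = {E. E \<subseteq> all_pairs n}"

definition complement_graph :: "nat \<Rightarrow> nat set set \<Rightarrow> nat set set" where
  "complement_graph n E = all_pairs n - E"

text \<open>For \<open>i = j\<close> the set \<open>{i, j}\<close> is a singleton, hence never an edge: the diagonal is zero.\<close>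

definition adjacency_matrix :: "nat \<Rightarrow> nat set set \<Rightarrow> real mat" where
  "adjacency_matrix n E = mat n n (\<lambda>(i, j). if {i, j} \<in> E then 1 else 0)"

text \<open>
  The eigenvalues with algebraic multiplicity.  The adjacency matrix is real symmetric, so its
  characteristic polynomial splits over the reals and this multiset has size \<open>n\<close>.
\<close>

definition adjacency_eigenvalues :: "nat \<Rightarrow> nat set set \<Rightarrow> real multiset" where
  "adjacency_eigenvalues n E = proots (char_poly (adjacency_matrix n E))"

text \<open>
  The \<open>i\<close>-th largest singular value, counted from \<open>i = 1\<close>; meaningful for \<open>1 \<le> i \<le> n\<close> only.
\<close>

definition singular_value :: "nat \<Rightarrow> nat \<Rightarrow> nat set set \<Rightarrow> real" where
  "singular_value i n E =
     rev (sorted_list_of_multiset (image_mset abs (adjacency_eigenvalues n E))) ! (i - 1)"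

definition f_star_n :: "nat \<Rightarrow> nat \<Rightarrow> real" where
  "f_star_n k n =
     Max ((\<lambda>E. singular_value k n E + singular_value k n (complement_graph n E)) ` graphs_of_order n)"

text \<open>The finitely many \<open>n < k\<close>, where \<open>f_star_n k n\<close> is meaningless, do not affect the limit.\<close>

definition f_star :: "nat \<Rightarrow> real" where
  "f_star k = lim (\<lambda>n. f_star_n k n / real n)"

end

theory Submission
  imports
    Defs
    "Jordan_Normal_Form.Spectral_Radius"
    "HOL-Analysis.L2_Norm"
    "HOL-Real_Asymp.Real_Asymp"
begin

text \<open>
  Write \<open>A\<close> for the adjacency matrix of a graph of order \<open>n\<close>, \<open>S\<close> for the sum of its entries and
  \<open>s\<^sub>1 \<ge> s\<^sub>2 \<ge> \<dots>\<close> for its singular values.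

  Upper bound.  The entries of \<open>A\<close> are 0 or 1, so \<open>S\<close> is also the squared Frobenius norm, that is,
  the sum of all squared singular values.  The all-ones vector shows that \<open>s\<^sub>1 \<ge> S / n\<close>.  Removing
  the first singular value, the next \<open>k - 1\<close> satisfy \<open>(k - 1) s\<^sub>k\<^sup>2 \<le> S - (S / n)\<^sup>2 \<le> (n / 2)\<^sup>2\<close>,
  hence \<open>s\<^sub>k \<le> n / (2 \<surd>(k - 1))\<close>.  This applies to the graph and to its complement
  (\<open>singular_value_le\<close>).

  Lower bound.  Let \<open>s\<close> be the least positive integer with \<open>s\<^sup>2 \<ge> k - 1\<close>; then \<open>s < \<surd>(k - 1) + 1\<close>,
  and it suffices to reach \<open>1 / s\<close>.  Suppose that \<open>H\<close> is a symmetric \<open>\<plusminus>1\<close> matrix of order \<open>N\<close> with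
  zero row sums and with \<open>s\<^sup>2\<close> singular values equal to \<open>N / s\<close>.  Up to a correction of the
  diagonal, which moves singular values by at most 1, the matrices \<open>(J + H) / 2\<close> and
  \<open>(J - H) / 2\<close>, with \<open>J\<close> the all-ones matrix, are the adjacency matrices of a graph and of its
  complement.  As \<open>H\<close> annihilates the all-ones vector, each of the two has \<open>s\<^sup>2 + 1 \<ge> k\<close> singular
  values that are at least \<open>N / (2 s)\<close>.  Kharaghani's method supplies such an \<open>H\<close>: take mutually
  orthogonal \<open>\<plusminus>1\<close> vectors \<open>r\<^sub>0, \<dots>, r\<^sub>s\<^sub>-\<^sub>1\<close> of length \<open>h\<close>, all with zero sum (here Rademacher
  functions), and place the rank one blocks \<open>r\<^sub>a r\<^sub>a\<^sup>T\<close> along a symmetric Latin square of order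
  \<open>s\<close>. The products of distinct blocks vanish, so \<open>H\<close> maps the vectors that equal \<open>r\<^sub>a\<close> on one
  block and 0 elsewhere to orthogonal vectors, \<open>h = N / s\<close> times as long (\<open>kharaghani_expands\<close>).

  Existence of the limit.  The maximum is nondecreasing in \<open>n\<close>, because enlarging a graph does not
  decrease its singular values, and it is superadditive up to a linear error, because replacing
  each vertex by \<open>t\<close> independent copies multiplies the singular values by \<open>t\<close> and changes the
  complement, beyond that, only by a matrix of norm \<open>t - 1\<close>.  A Fekete argument then gives
  convergence (\<open>almost_superadditive_ratio_converges\<close>).

  All comparisons of singular values pass through the Courant--Fischer principle
  (\<open>singular_value_ge_iff\<close>): \<open>s\<^sub>k \<ge> c\<close> holds iff the matrix stretches all vectors of some
  \<open>k\<close>-dimensional subspace by a factor of at least \<open>c\<close>.  It rests on the spectral theorem for real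
  symmetric matrices, which also links the roots of the characteristic polynomial to an
  orthonormal eigenbasis.
\<close>

section \<open>The spectral theorem for real symmetric matrices\<close>

text \<open>
  Over the complex numbers an eigenvalue \<open>z\<close> exists.  For an eigenvector \<open>a + i b\<close>, symmetry of
  the bilinear form \<open>b\<^sup>T A a\<close> gives \<open>Im z * (|a|\<^sup>2 + |b|\<^sup>2) = 0\<close>; so \<open>z\<close> is real, and \<open>a\<close> or \<open>b\<close>
  is a real eigenvector.
\<close>
lemma real_symmetric_has_eigenvector:
  fixes A :: "real mat"
  assumes A: "A \<in> carrier_mat n n" and sym: "transpose_mat A = A" and n: "n > 0"
  obtains e v where "eigenvector A v e"
proof -
  let ?C = "map_mat complex_of_real A"
  have C: "?C \<in> carrier_mat n n" using A by simp
  from spectrum_non_empty[OF C n] obtain z where "eigenvalue ?C z"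
    unfolding spectrum_def by auto
  then obtain w where w: "w \<in> carrier_vec n" "w \<noteq> 0\<^sub>v n" and ev: "?C *\<^sub>v w = z \<cdot>\<^sub>v w"
    using A unfolding eigenvalue_def eigenvector_def by auto
  define a where "a i = Re (w $ i)" for i
  define b where "b i = Im (w $ i)" for i
  have symi: "A $$ (i,j) = A $$ (j,i)" if "i < n" "j < n" for i j
    using that A arg_cong[OF sym, of "\<lambda>M. M $$ (i,j)"] by simp
  have evi: "(\<Sum>j<n. complex_of_real (A $$ (i,j)) * w $ j) = z * w $ i" if "i < n" for i
    using arg_cong[OF ev, of "\<lambda>x. x $ i"] that w A
    by (simp add: scalar_prod_def lessThan_atLeast0)
  have eva: "(\<Sum>j<n. A $$ (i,j) * a j) = Re z * a i - Im z * b i" if "i < n" for i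
    using arg_cong[OF evi[OF that], of Re] by (simp add: a_def b_def)
  have evb: "(\<Sum>j<n. A $$ (i,j) * b j) = Im z * a i + Re z * b i" if "i < n" for i
    using arg_cong[OF evi[OF that], of Im] by (simp add: a_def b_def)
  have "(\<Sum>i<n. b i * (\<Sum>j<n. A $$ (i,j) * a j)) = (\<Sum>i<n. \<Sum>j<n. A $$ (i,j) * b i * a j)"
    by (simp add: sum_distrib_left mult_ac)
  also have "\<dots> = (\<Sum>j<n. \<Sum>i<n. A $$ (i,j) * b i * a j)"
    by (rule sum.swap)
  also have "\<dots> = (\<Sum>j<n. a j * (\<Sum>i<n. A $$ (j,i) * b i))"
    by (auto simp: sum_distrib_left mult_ac symi intro!: sum.cong)
  finally have "(\<Sum>i<n. b i * (Re z * a i - Im z * b i)) = (\<Sum>j<n. a j * (Im z * a j + Re z * b j))"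
    by (simp add: eva evb)
  then have "Im z * (\<Sum>i<n. (a i)\<^sup>2 + (b i)\<^sup>2) = 0"
    by (simp add: algebra_simps power2_eq_square sum_distrib_left sum.distrib sum_subtractf)
  moreover obtain i0 where i0: "i0 < n" "w $ i0 \<noteq> 0"
    using w by (metis carrier_vecD eq_vecI index_zero_vec(1) index_zero_vec(2))
  have "(\<Sum>i<n. (a i)\<^sup>2 + (b i)\<^sup>2) > 0"
    using i0 by (intro sum_pos2[of _ i0]) (auto simp: a_def b_def complex_neq_0)
  ultimately have z: "Im z = 0" by simp
  have key: "eigenvector A (vec n c) (Re z)"
    if c: "i < n" "c i \<noteq> 0" "\<And>i. i < n \<Longrightarrow> (\<Sum>j<n. A $$ (i,j) * c j) = Re z * c i" for c i
    unfolding eigenvector_def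
  proof (intro conjI)
    show "vec n c \<in> carrier_vec (dim_row A)" using A by simp
    show "vec n c \<noteq> 0\<^sub>v (dim_row A)"
      using A c(1,2) by (metis carrier_matD(1) index_vec index_zero_vec(1))
    show "A *\<^sub>v vec n c = Re z \<cdot>\<^sub>v vec n c"
      using A c(3) by (intro eq_vecI) (auto simp: scalar_prod_def lessThan_atLeast0)
  qed
  show thesis
  proof (cases "a i0 = 0")
    case False
    then show ?thesis using that key[of i0 a] i0 eva z by auto
  next
    case True
    then have "b i0 \<noteq> 0" using i0 by (simp add: a_def b_def complex_eq_iff)
    then show ?thesis using that key[of i0 b] i0 evb z by auto
  qed
qed

text \<open>
  The sign condition on the first coordinate keeps the vector away from the first basis vector, so
  that the reflection below that exchanges the two has a nonzero normal vector.
\<close>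
lemma real_symmetric_has_unit_eigenvector:
  fixes A :: "real mat"
  assumes A: "A \<in> carrier_mat n n" and sym: "transpose_mat A = A" and n: "n > 0"
  obtains e v where "v \<in> carrier_vec n" "A *\<^sub>v v = e \<cdot>\<^sub>v v" "(\<Sum>i<n. (v $ i)\<^sup>2) = 1" "v $ 0 \<le> 0"
proof -
  from real_symmetric_has_eigenvector[OF assms] obtain e v where ev: "eigenvector A v e" .
  then have v: "v \<in> carrier_vec n" "v \<noteq> 0\<^sub>v n" "A *\<^sub>v v = e \<cdot>\<^sub>v v"
    using A unfolding eigenvector_def by auto
  define N where "N = (\<Sum>i<n. (v $ i)\<^sup>2)"
  obtain i0 where i0: "i0 < n" "v $ i0 \<noteq> 0"
    using v by (metis carrier_vecD eq_vecI index_zero_vec(1) index_zero_vec(2))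
  have N: "N > 0"
    unfolding N_def using i0 by (intro sum_pos2[of _ i0]) auto
  define c where "c = (if v $ 0 \<le> 0 then 1 else -1) / sqrt N"
  have c2: "c\<^sup>2 = 1 / N" using N by (simp add: c_def power_divide)
  show thesis
  proof (rule that[of "c \<cdot>\<^sub>v v" e])
    show "c \<cdot>\<^sub>v v \<in> carrier_vec n" using v by simp
    show "A *\<^sub>v (c \<cdot>\<^sub>v v) = e \<cdot>\<^sub>v (c \<cdot>\<^sub>v v)"
      using v A by (simp add: mult_mat_vec smult_smult_assoc mult.commute)
    have "(\<Sum>i<n. ((c \<cdot>\<^sub>v v) $ i)\<^sup>2) = c\<^sup>2 * N"
      using v by (simp add: N_def sum_distrib_left power_mult_distrib)
    then show "(\<Sum>i<n. ((c \<cdot>\<^sub>v v) $ i)\<^sup>2) = 1" using N c2 by simp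
    show "(c \<cdot>\<^sub>v v) $ 0 \<le> 0"
      using v n N by (auto simp: c_def divide_le_0_iff)
  qed
qed

text \<open>
  The Householder reflection along \<open>w = v - e\<^sub>0\<close>: it is symmetric and involutive and exchanges \<open>v\<close>
  and \<open>e\<^sub>0\<close>.  Here \<open>|w|\<^sup>2 = 2 * (1 - v\<^sub>0)\<close>, which gives the denominator \<open>c\<close>.
\<close>
lemma unit_vector_first_column_of_reflection:
  fixes v :: "real vec"
  assumes v: "v \<in> carrier_vec n" and n: "n > 0"
    and unit: "(\<Sum>i<n. (v $ i)\<^sup>2) = 1" and v0: "v $ 0 \<le> 0"
  obtains H :: "real mat" where "H \<in> carrier_mat n n" "transpose_mat H = H" "H * H = 1\<^sub>m n" "col H 0 = v"
proof -
  define c where "c = 1 - v $ 0"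
  define w where "w i = v $ i - (if i = 0 then 1 else 0)" for i
  define h where "h i j = (if i = j then 1 else 0) - w i * w j / c" for i j
  let ?H = "mat n n (\<lambda>(i,j). h i j)"
  have c: "c > 0" using v0 by (simp add: c_def)
  have "(\<Sum>i<n. (w i)\<^sup>2) = (\<Sum>i<n. (v $ i)\<^sup>2 + (if i = 0 then 1 - 2 * v $ i else 0))"
    by (intro sum.cong) (auto simp: w_def power2_eq_square algebra_simps)
  also have "\<dots> = 1 + (1 - 2 * v $ 0)"
    using n unit by (simp add: sum.distrib)
  finally have w2: "(\<Sum>i<n. (w i)\<^sup>2) = 2 * c" by (simp add: c_def)
  have hh: "(\<Sum>k<n. h i k * h k j) = (if i = j then 1 else 0)" if ij: "i < n" "j < n" for i j
  proof -
    have w2': "(\<Sum>k<n. w i * w j / c\<^sup>2 * (w k)\<^sup>2) = w i * w j / c\<^sup>2 * (2 * c)"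
      by (simp only: w2 flip: sum_distrib_left)
    have "(\<Sum>k<n. h i k * h k j) = (\<Sum>k<n. (if k = i then (if i = j then 1 else 0) - w i * w j / c else 0)
       - (if k = j then w i * w j / c else 0) + w i * w j / c\<^sup>2 * (w k)\<^sup>2)"
      by (intro sum.cong) (auto simp: h_def algebra_simps power2_eq_square)
    also have "\<dots> = (if i = j then 1 else 0) - 2 * (w i * w j / c) + w i * w j / c\<^sup>2 * (2 * c)"
      unfolding sum.distrib sum_subtractf w2' using ij by simp
    also have "\<dots> = (if i = j then 1 else 0)" using c by (simp add: power2_eq_square)
    finally show ?thesis .
  qed
  show thesis
  proof (rule that[of ?H])
    show "?H \<in> carrier_mat n n" by simp
    show "transpose_mat ?H = ?H" by (intro eq_matI) (auto simp: h_def)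
    show "?H * ?H = 1\<^sub>m n"
      using hh by (intro eq_matI) (auto simp: scalar_prod_def lessThan_atLeast0)
    have "h i 0 = v $ i" for i
      using c by (simp add: h_def w_def c_def field_simps)
    then show "col ?H 0 = v" using v n by (intro eq_vecI) auto
  qed
qed

text \<open>
  Deflation: conjugating with a reflection \<open>H\<close> whose first column is an eigenvector turns \<open>A\<close> into
  a symmetric matrix whose first column, and hence first row, is zero off the diagonal.  The
  induction hypothesis diagonalizes the remaining block.
\<close>
lemma real_symmetric_orthogonally_diagonalizable:
  fixes A :: "real mat"
  assumes "A \<in> carrier_mat n n" "transpose_mat A = A"
  shows "\<exists>U D. U \<in> carrier_mat n n \<and> D \<in> carrier_mat n n \<and> diagonal_mat D
     \<and> transpose_mat U * U = 1\<^sub>m n \<and> A = U * D * transpose_mat U"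
  using assms
proof (induction n arbitrary: A)
  case 0
  then show ?case
    by (intro exI[of _ A]) (auto simp: diagonal_mat_def)
next
  case (Suc n)
  let ?N = "Suc n"
  note A = Suc.prems(1)
  from real_symmetric_has_unit_eigenvector[OF Suc.prems] obtain e v where
    v: "v \<in> carrier_vec ?N" "A *\<^sub>v v = e \<cdot>\<^sub>v v" "(\<Sum>i<?N. (v $ i)\<^sup>2) = 1" "v $ 0 \<le> 0" by blast
  from unit_vector_first_column_of_reflection[OF v(1) _ v(3,4)] obtain H where
    H: "H \<in> carrier_mat ?N ?N" "transpose_mat H = H" "H * H = 1\<^sub>m ?N" "col H 0 = v" by blast
  define B where "B = H * (A * H)"
  have B: "B \<in> carrier_mat ?N ?N" using A H by (simp add: B_def)
  have Bsym: "transpose_mat B = B"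
    using A H Suc.prems(2) by (simp add: B_def transpose_mult[of _ ?N ?N _ ?N] assoc_mult_mat[of _ ?N ?N _ ?N _ ?N])
  have "col B 0 = H *\<^sub>v col (A * H) 0"
    unfolding B_def using A H by (intro col_mult2[of _ ?N ?N _ ?N]) auto
  also have "col (A * H) 0 = A *\<^sub>v col H 0"
    using A H by (intro col_mult2[of _ ?N ?N _ ?N]) auto
  also have "H *\<^sub>v (A *\<^sub>v col H 0) = e \<cdot>\<^sub>v (H *\<^sub>v col H 0)"
    using v H by (simp add: mult_mat_vec[of _ ?N ?N])
  also have "H *\<^sub>v col H 0 = col (1\<^sub>m ?N) 0"
    using col_mult2[OF H(1) H(1), of 0] H(3) by simp
  finally have col0: "col B 0 = e \<cdot>\<^sub>v unit_vec ?N 0" by simp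
  have B0: "B $$ (i,0) = (if i = 0 then e else 0)" if "i < ?N" for i
    using arg_cong[OF col0, of "\<lambda>x. x $ i"] that B by auto
  have Bij: "B $$ (i,j) = B $$ (j,i)" if "i < ?N" "j < ?N" for i j
    using that B arg_cong[OF Bsym, of "\<lambda>M. M $$ (i,j)"] by simp
  define B' where "B' = mat n n (\<lambda>(i,j). B $$ (Suc i, Suc j))"
  let ?E = "mat 1 1 (\<lambda>_. e)"
  have Bblock: "B = four_block_mat ?E (0\<^sub>m 1 n) (0\<^sub>m n 1) B'"
    using B B0 Bij[of 0] by (intro eq_matI) (auto simp: B'_def)
  have B': "B' \<in> carrier_mat n n" by (simp add: B'_def)
  have "transpose_mat B' = B'"
    using Bij by (intro eq_matI) (auto simp: B'_def)
  from Suc.IH[OF B' this] obtain U D where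
    U: "U \<in> carrier_mat n n" and D: "D \<in> carrier_mat n n" "diagonal_mat D"
    and UU: "transpose_mat U * U = 1\<^sub>m n" and B'U: "B' = U * D * transpose_mat U" by blast
  define V where "V = four_block_mat (1\<^sub>m 1) (0\<^sub>m 1 n) (0\<^sub>m n 1) U"
  define F where "F = four_block_mat ?E (0\<^sub>m 1 n) (0\<^sub>m n 1) D"
  have V: "V \<in> carrier_mat ?N ?N" using four_block_carrier_mat[of "1\<^sub>m 1" 1 1 U n n] U by (simp add: V_def)
  have F: "F \<in> carrier_mat ?N ?N" using four_block_carrier_mat[of ?E 1 1 D n n] D by (simp add: F_def)
  have Vt: "transpose_mat V = four_block_mat (1\<^sub>m 1) (0\<^sub>m 1 n) (0\<^sub>m n 1) (transpose_mat U)"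
    using U by (simp add: V_def transpose_four_block_mat[of _ 1 1 _ n _ n])
  have Ut: "transpose_mat U \<in> carrier_mat n n" using U by simp
  have VV: "transpose_mat V * V = 1\<^sub>m ?N"
    unfolding Vt unfolding V_def
    by (subst mult_four_block_mat[of _ 1 1 _ n _ n _ _ 1 _ n])
      (use U Ut UU four_block_one_mat[of 1 n] in auto)
  have VF: "V * F = four_block_mat ?E (0\<^sub>m 1 n) (0\<^sub>m n 1) (U * D)"
    unfolding V_def F_def
    by (subst mult_four_block_mat[of _ 1 1 _ n _ n _ _ 1 _ n])
      (use U D in auto)
  have BV: "B = V * F * transpose_mat V"
    unfolding VF Vt Bblock B'U
    by (subst mult_four_block_mat[of _ 1 1 _ n _ n _ _ 1 _ n])
      (use U D Ut in auto)
  have "A = (H * H) * (A * (H * H))" unfolding H(3) using A by simp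
  also have "\<dots> = H * B * H"
    using A H(1) unfolding B_def by (simp add: assoc_mult_mat[of _ ?N ?N _ ?N _ ?N])
  also have "\<dots> = (H * V) * F * transpose_mat (H * V)"
    unfolding BV using H V F
    by (simp add: transpose_mult[of _ ?N ?N _ ?N] assoc_mult_mat[of _ ?N ?N _ ?N _ ?N])
  finally have fin: "A = (H * V) * F * transpose_mat (H * V)" .
  have "transpose_mat (H * V) * (H * V) = transpose_mat V * (H * H) * V"
    using H(1,2) V by (simp add: transpose_mult[of _ ?N ?N _ ?N] assoc_mult_mat[of _ ?N ?N _ ?N _ ?N])
  also have "\<dots> = 1\<^sub>m ?N" unfolding H(3) using V VV by simp
  finally have orth: "transpose_mat (H * V) * (H * V) = 1\<^sub>m ?N" .
  have "diagonal_mat F"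
    using D unfolding diagonal_mat_def F_def by auto
  then show ?case
    using fin orth F H V by (intro exI[of _ "H * V"] exI[of _ F]) auto
qed

section \<open>Singular values as largest uniform expansions\<close>

text \<open>
  Padding the system with zero rows makes it square with vanishing determinant.
\<close>
lemma homogeneous_system_nontrivial_solution:
  fixes B :: "nat \<Rightarrow> nat \<Rightarrow> real"
  assumes "r < k"
  obtains a where "\<exists>j<k. a j \<noteq> 0" "\<And>i. i < r \<Longrightarrow> (\<Sum>j<k. B i j * a j) = 0"
proof -
  define C where "C = mat k k (\<lambda>(i,j). if i < r then B i j else 0)"
  have C: "C \<in> carrier_mat k k" by (simp add: C_def)
  have "row C r = 0\<^sub>v k" using assms by (intro eq_vecI) (auto simp: C_def)
  have "det C = 0"
    using laplace_expansion_row[OF C assms] assms by (simp add: C_def)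
  then obtain x where x: "x \<in> carrier_vec k" "x \<noteq> 0\<^sub>v k" "C *\<^sub>v x = 0\<^sub>v k"
    using det_0_iff_vec_prod_zero_field[OF C] by blast
  show thesis
  proof (rule that[of "\<lambda>j. x $ j"])
    show "\<exists>j<k. x $ j \<noteq> 0"
      using x by (metis carrier_vecD eq_vecI index_zero_vec(1) index_zero_vec(2))
    show "(\<Sum>j<k. B i j * x $ j) = 0" if "i < r" for i
      using arg_cong[OF x(3), of "\<lambda>y. y $ i"] that assms x(1)
      by (simp add: C_def scalar_prod_def lessThan_atLeast0)
  qed
qed

definition mat_app :: "nat \<Rightarrow> (nat \<Rightarrow> nat \<Rightarrow> real) \<Rightarrow> (nat \<Rightarrow> real) \<Rightarrow> nat \<Rightarrow> real" where
  "mat_app n M x v = (\<Sum>w<n. M v w * x w)"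

definition lincomb :: "nat \<Rightarrow> (nat \<Rightarrow> nat \<Rightarrow> real) \<Rightarrow> (nat \<Rightarrow> real) \<Rightarrow> nat \<Rightarrow> real" where
  "lincomb k X a v = (\<Sum>i<k. a i * X i v)"

lemma L2_set_sq: "(L2_set f A)\<^sup>2 = (\<Sum>i\<in>A. (f i)\<^sup>2)"
  by (simp add: L2_set_def sum_nonneg)

text \<open>
  The rows \<open>u i\<close> form an orthonormal eigenbasis, listed by decreasing modulus of the eigenvalue.
  For a square matrix, orthonormality of the rows and of the columns are equivalent; both forms
  are recorded since both are used.
\<close>
locale sorted_eigenbasis =
  fixes n :: nat and M :: "nat \<Rightarrow> nat \<Rightarrow> real" and u :: "nat \<Rightarrow> nat \<Rightarrow> real" and e :: "nat \<Rightarrow> real"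
  assumes sym: "v < n \<Longrightarrow> w < n \<Longrightarrow> M v w = M w v"
    and orthonormal: "i < n \<Longrightarrow> j < n \<Longrightarrow> (\<Sum>v<n. u i v * u j v) = (if i = j then 1 else 0)"
    and complete: "v < n \<Longrightarrow> w < n \<Longrightarrow> (\<Sum>i<n. u i v * u i w) = (if v = w then 1 else 0)"
    and eigen: "i < n \<Longrightarrow> v < n \<Longrightarrow> mat_app n M (u i) v = e i * u i v"
    and decreasing: "i \<le> j \<Longrightarrow> j < n \<Longrightarrow> \<bar>e j\<bar> \<le> \<bar>e i\<bar>"
begin

definition coord :: "(nat \<Rightarrow> real) \<Rightarrow> nat \<Rightarrow> real" where
  "coord x i = (\<Sum>v<n. u i v * x v)"

lemma parseval: "(L2_set x {..<n})\<^sup>2 = (\<Sum>i<n. (coord x i)\<^sup>2)"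
proof -
  have "(\<Sum>i<n. (coord x i)\<^sup>2) = (\<Sum>i<n. \<Sum>v<n. \<Sum>w<n. u i v * u i w * (x v * x w))"
    by (simp add: coord_def power2_eq_square sum_product mult_ac)
  also have "\<dots> = (\<Sum>v<n. \<Sum>i<n. \<Sum>w<n. u i v * u i w * (x v * x w))"
    by (rule sum.swap)
  also have "\<dots> = (\<Sum>v<n. \<Sum>w<n. \<Sum>i<n. u i v * u i w * (x v * x w))"
    by (intro sum.cong refl sum.swap)
  also have "\<dots> = (\<Sum>v<n. \<Sum>w<n. (\<Sum>i<n. u i v * u i w) * (x v * x w))"
    by (simp add: sum_distrib_right)
  also have "\<dots> = (\<Sum>v<n. \<Sum>w<n. if v = w then x v * x w else 0)"
    by (intro sum.cong refl) (simp add: complete)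
  also have "\<dots> = (\<Sum>v<n. (x v)\<^sup>2)"
    by (simp add: power2_eq_square)
  finally show ?thesis by (simp add: L2_set_sq)
qed

lemma coord_mat_app:
  assumes "i < n"
  shows "coord (mat_app n M x) i = e i * coord x i"
proof -
  have "coord (mat_app n M x) i = (\<Sum>v<n. \<Sum>w<n. M v w * u i v * x w)"
    by (simp add: coord_def mat_app_def sum_distrib_left mult_ac)
  also have "\<dots> = (\<Sum>w<n. \<Sum>v<n. M v w * u i v * x w)"
    by (rule sum.swap)
  also have "\<dots> = (\<Sum>w<n. mat_app n M (u i) w * x w)"
    by (intro sum.cong refl) (auto simp: mat_app_def sum_distrib_right sym intro!: sum.cong)
  also have "\<dots> = e i * coord x i"
    using assms by (simp add: eigen coord_def sum_distrib_left mult_ac)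
  finally show ?thesis .
qed

lemma norm_mat_app: "(L2_set (mat_app n M x) {..<n})\<^sup>2 = (\<Sum>i<n. (e i)\<^sup>2 * (coord x i)\<^sup>2)"
  by (simp add: parseval coord_mat_app power_mult_distrib)

lemma norm_mat_app_le:
  "L2_set (mat_app n M x) {..<n} \<le> \<bar>e 0\<bar> * L2_set x {..<n}"
proof (rule power2_le_imp_le)
  have "(L2_set (mat_app n M x) {..<n})\<^sup>2 \<le> (\<Sum>i<n. (e 0)\<^sup>2 * (coord x i)\<^sup>2)"
    unfolding norm_mat_app using decreasing[of 0]
    by (intro sum_mono mult_right_mono) (auto simp flip: abs_le_square_iff)
  then show "(L2_set (mat_app n M x) {..<n})\<^sup>2 \<le> (\<bar>e 0\<bar> * L2_set x {..<n})\<^sup>2"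
    by (simp add: power_mult_distrib parseval sum_distrib_left)
qed (simp add: L2_set_nonneg)

text \<open>The squared norms of the columns of \<open>M\<close>, computed in the eigenbasis.\<close>
lemma frobenius: "(\<Sum>v<n. \<Sum>w<n. (M v w)\<^sup>2) = (\<Sum>i<n. (e i)\<^sup>2)"
proof -
  have "(\<Sum>w<n. (M v w)\<^sup>2) = (\<Sum>i<n. (e i)\<^sup>2 * (u i v)\<^sup>2)" if "v < n" for v
  proof -
    have delta: "(\<Sum>w<n. f w * (if w = v then 1 else 0)) = f v" for f :: "nat \<Rightarrow> real"
      using that by (simp add: if_distrib cong: if_cong)
    have "(\<Sum>w<n. (M v w)\<^sup>2) = (L2_set (mat_app n M (\<lambda>w. if w = v then 1 else 0)) {..<n})\<^sup>2"
      using that by (auto simp: L2_set_sq mat_app_def delta sym[of v] intro!: sum.cong)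
    also have "\<dots> = (\<Sum>i<n. (e i)\<^sup>2 * (u i v)\<^sup>2)"
      by (simp add: norm_mat_app coord_def delta)
    finally show ?thesis .
  qed
  then have "(\<Sum>v<n. \<Sum>w<n. (M v w)\<^sup>2) = (\<Sum>v<n. \<Sum>i<n. (e i)\<^sup>2 * (u i v)\<^sup>2)"
    by simp
  also have "\<dots> = (\<Sum>i<n. (e i)\<^sup>2 * (\<Sum>v<n. u i v * u i v))"
    by (subst sum.swap) (simp add: sum_distrib_left power2_eq_square)
  also have "\<dots> = (\<Sum>i<n. (e i)\<^sup>2)"
    by (simp add: orthonormal)
  finally show ?thesis .
qed

end

text \<open>
  There is a \<open>k\<close>-dimensional space of vectors on which \<open>M\<close> increases the Euclidean norm by a
  factor of at least \<open>c\<close>. The space is given by a basis; linear independence is the positivity of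
  the norms of nontrivial combinations.
\<close>
definition expands :: "nat \<Rightarrow> (nat \<Rightarrow> nat \<Rightarrow> real) \<Rightarrow> nat \<Rightarrow> real \<Rightarrow> bool" where
  "expands n M k c \<longleftrightarrow> (\<exists>X. \<forall>a. (\<exists>i<k. a i \<noteq> 0) \<longrightarrow>
     0 < L2_set (lincomb k X a) {..<n} \<and>
     c * L2_set (lincomb k X a) {..<n} \<le> L2_set (mat_app n M (lincomb k X a)) {..<n})"

text \<open>
  A space of dimension \<open>k\<close> contains a nonzero vector orthogonal to the first \<open>k - 1\<close> eigenvectors,
  and such a vector is stretched by at most \<open>\<bar>e (k - 1)\<bar>\<close>.  Conversely, the first \<open>k\<close> eigenvectors
  span a space on which every vector is stretched by at least that factor.
\<close>
lemma (in sorted_eigenbasis) courant_fischer: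
  assumes k: "1 \<le> k" "k \<le> n"
  shows "expands n M k c \<longleftrightarrow> c \<le> \<bar>e (k - 1)\<bar>"
proof
  assume "expands n M k c"
  then obtain X where X: "\<And>a. \<exists>i<k. a i \<noteq> 0 \<Longrightarrow>
     0 < L2_set (lincomb k X a) {..<n} \<and>
     c * L2_set (lincomb k X a) {..<n} \<le> L2_set (mat_app n M (lincomb k X a)) {..<n}"
    unfolding expands_def by blast
  have "k - 1 < k" using k by simp
  then obtain a where a: "\<exists>j<k. a j \<noteq> 0" "\<And>i. i < k - 1 \<Longrightarrow> (\<Sum>j<k. coord (X j) i * a j) = 0"
    using homogeneous_system_nontrivial_solution[of "k - 1" k "\<lambda>i j. coord (X j) i"] by blast
  define x where "x = lincomb k X a"
  have cx: "coord x i = (\<Sum>j<k. coord (X j) i * a j)" for i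
    unfolding coord_def x_def lincomb_def sum_distrib_left sum_distrib_right
    by (subst sum.swap) (simp add: mult_ac)
  have "(L2_set (mat_app n M x) {..<n})\<^sup>2 \<le> (\<Sum>i<n. (e (k - 1))\<^sup>2 * (coord x i)\<^sup>2)"
    unfolding norm_mat_app
  proof (intro sum_mono)
    fix i assume i: "i \<in> {..<n}"
    show "(e i)\<^sup>2 * (coord x i)\<^sup>2 \<le> (e (k - 1))\<^sup>2 * (coord x i)\<^sup>2"
    proof (cases "i < k - 1")
      case True
      then show ?thesis by (simp add: cx a(2))
    next
      case False
      then have "\<bar>e i\<bar> \<le> \<bar>e (k - 1)\<bar>" using i by (intro decreasing) auto
      then show ?thesis by (intro mult_right_mono) (auto simp: abs_le_square_iff)
    qed
  qed
  also have "\<dots> = (\<bar>e (k - 1)\<bar> * L2_set x {..<n})\<^sup>2"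
    by (simp add: power_mult_distrib parseval sum_distrib_left)
  finally have "L2_set (mat_app n M x) {..<n} \<le> \<bar>e (k - 1)\<bar> * L2_set x {..<n}"
    by (rule power2_le_imp_le) (simp add: L2_set_nonneg)
  moreover have "c * L2_set x {..<n} \<le> L2_set (mat_app n M x) {..<n}" "0 < L2_set x {..<n}"
    using X[OF a(1)] by (simp_all add: x_def)
  ultimately show "c \<le> \<bar>e (k - 1)\<bar>" by (meson mult_le_cancel_right_pos order_trans)
next
  assume c: "c \<le> \<bar>e (k - 1)\<bar>"
  show "expands n M k c"
    unfolding expands_def
  proof (intro exI[of _ u] allI impI)
    fix a :: "nat \<Rightarrow> real"
    assume a: "\<exists>i<k. a i \<noteq> 0"
    define x where "x = lincomb k u a"
    have cx: "coord x i = (if i < k then a i else 0)" if "i < n" for i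
    proof -
      have "coord x i = (\<Sum>j<k. a j * (\<Sum>v<n. u i v * u j v))"
        unfolding coord_def x_def lincomb_def sum_distrib_left
        by (subst sum.swap) (simp add: mult_ac)
      also have "\<dots> = (\<Sum>j<k. if i = j then a j else 0)"
        using that k by (intro sum.cong) (auto simp: orthonormal)
      finally show ?thesis by simp
    qed
    obtain i0 where i0: "i0 < k" "a i0 \<noteq> 0" using a by blast
    have "0 < (\<Sum>i<n. (coord x i)\<^sup>2)"
      using i0 k by (intro sum_pos2[of _ i0]) (auto simp: cx)
    then have pos: "0 < L2_set x {..<n}"
      using parseval[of x] by (metis L2_set_nonneg less_le power_zero_numeral)
    have "(\<bar>e (k - 1)\<bar> * L2_set x {..<n})\<^sup>2 = (\<Sum>i<n. (e (k - 1))\<^sup>2 * (coord x i)\<^sup>2)"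
      by (simp add: power_mult_distrib parseval sum_distrib_left)
    also have "\<dots> \<le> (L2_set (mat_app n M x) {..<n})\<^sup>2"
      unfolding norm_mat_app
    proof (intro sum_mono)
      fix i assume i: "i \<in> {..<n}"
      show "(e (k - 1))\<^sup>2 * (coord x i)\<^sup>2 \<le> (e i)\<^sup>2 * (coord x i)\<^sup>2"
      proof (cases "i < k")
        case False
        then show ?thesis using i by (simp add: cx)
      next
        case True
        then have "\<bar>e (k - 1)\<bar> \<le> \<bar>e i\<bar>" using k by (intro decreasing) auto
        then show ?thesis by (intro mult_right_mono) (auto simp: abs_le_square_iff)
      qed
    qed
    finally have "\<bar>e (k - 1)\<bar> * L2_set x {..<n} \<le> L2_set (mat_app n M x) {..<n}"
      by (rule power2_le_imp_le) (simp add: L2_set_nonneg)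
    with c pos have "c * L2_set x {..<n} \<le> L2_set (mat_app n M x) {..<n}"
      by (meson mult_right_mono less_imp_le order_trans)
    with pos show "0 < L2_set (lincomb k u a) {..<n} \<and>
     c * L2_set (lincomb k u a) {..<n} \<le> L2_set (mat_app n M (lincomb k u a)) {..<n}"
      unfolding x_def by simp
  qed
qed

lemma proots_linear_factors: "proots (\<Prod>a\<leftarrow>as. [:- a, 1:]) = mset as" for as :: "real list"
proof (induction as)
  case (Cons a as)
  have nz: "(\<Prod>a\<leftarrow>as. [:- a, 1:]) \<noteq> 0"
    by (induction as) (simp_all del: mult_pCons_left)
  have "proots ([:- a, 1:] * (\<Prod>a\<leftarrow>as. [:- a, 1:])) = proots [:- a, 1:] + proots (\<Prod>a\<leftarrow>as. [:- a, 1:])"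
    using nz by (intro Polynomial.proots_mult) auto
  then show ?case using Cons by (simp del: mult_pCons_left)
qed simp

text \<open>
  The diagonal form computes the characteristic polynomial, so its roots with multiplicity are the
  diagonal entries; permuting the columns of the diagonalizing matrix sorts them by modulus.
\<close>
lemma sorted_eigenbasis_exists:
  fixes M :: "nat \<Rightarrow> nat \<Rightarrow> real"
  assumes sym: "\<And>v w. v < n \<Longrightarrow> w < n \<Longrightarrow> M v w = M w v"
  obtains u e where "sorted_eigenbasis n M u e"
    "rev (sorted_list_of_multiset (image_mset abs (proots (char_poly (mat n n (\<lambda>(i,j). M i j))))))
       = map (\<lambda>i. \<bar>e i\<bar>) [0..<n]"
proof -
  let ?A = "mat n n (\<lambda>(i,j). M i j)"
  have A: "?A \<in> carrier_mat n n" by simp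
  have "transpose_mat ?A = ?A" using sym by (intro eq_matI) auto
  from real_symmetric_orthogonally_diagonalizable[OF A this] obtain U D where
    U: "U \<in> carrier_mat n n" and D: "D \<in> carrier_mat n n" "diagonal_mat D"
    and UU: "transpose_mat U * U = 1\<^sub>m n" and AU: "?A = U * D * transpose_mat U" by blast
  have Ut: "transpose_mat U \<in> carrier_mat n n" using U by simp
  have UU': "U * transpose_mat U = 1\<^sub>m n"
    by (rule mat_mult_left_right_inverse[OF Ut U UU])
  define d where "d i = D $$ (i,i)" for i
  \<comment> \<open>the column indices, ordered by decreasing modulus of the eigenvalue\<close>
  define p where "p = sort_key (\<lambda>i. - \<bar>d i\<bar>) [0..<n]"
  have len: "length p = n" by (simp add: p_def)
  have set: "set p = {..<n}" and dist: "distinct p" and mset: "mset p = mset [0..<n]"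
    by (auto simp: p_def)
  have sp: "sorted (map (\<lambda>i. - \<bar>d i\<bar>) p)" unfolding p_def by simp
  have pn: "p ! i < n" if "i < n" for i
    using that len set by (metis lessThan_iff nth_mem)
  have bij: "bij_betw (\<lambda>i. p ! i) {..<n} {..<n}"
    by (rule bij_betw_nth[OF dist]) (simp_all only: len set)
  define u where "u i v = U $$ (v, p ! i)" for i v
  define e where "e i = d (p ! i)" for i
  have orth: "(\<Sum>v<n. U $$ (v,i) * U $$ (v,j)) = (if i = j then 1 else 0)" if "i < n" "j < n" for i j
    using arg_cong[OF UU, of "\<lambda>B. B $$ (i,j)"] that U by (simp add: scalar_prod_def lessThan_atLeast0)
  have comp: "(\<Sum>i<n. U $$ (v,i) * U $$ (w,i)) = (if v = w then 1 else 0)" if "v < n" "w < n" for v w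
    using arg_cong[OF UU', of "\<lambda>B. B $$ (v,w)"] that U by (simp add: scalar_prod_def lessThan_atLeast0)
  have "U * D * transpose_mat U * U = U * D * (transpose_mat U * U)"
    by (rule assoc_mult_mat[of _ n n _ n _ n]) (use U D Ut in auto)
  also have "\<dots> = U * D"
    unfolding UU using U D by simp
  finally have AU': "?A * U = U * D" by (simp only: AU)
  have eig: "(\<Sum>w<n. M v w * U $$ (w,i)) = d i * U $$ (v,i)" if vi: "v < n" "i < n" for v i
  proof -
    have "(\<Sum>w<n. M v w * U $$ (w,i)) = (U * D) $$ (v,i)"
      using arg_cong[OF AU', of "\<lambda>B. B $$ (v,i)"] vi U by (simp add: scalar_prod_def lessThan_atLeast0)
    also have "\<dots> = (\<Sum>w<n. U $$ (v,w) * D $$ (w,i))"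
      using vi U D by (simp add: scalar_prod_def lessThan_atLeast0)
    also have "\<dots> = (\<Sum>w<n. if w = i then U $$ (v,w) * d i else 0)"
      using vi D by (intro sum.cong) (auto simp: d_def diagonal_mat_def)
    finally show ?thesis using vi by simp
  qed
  have basis: "sorted_eigenbasis n M u e"
  proof
    show "(\<Sum>v<n. u i v * u j v) = (if i = j then 1 else 0)" if "i < n" "j < n" for i j
      using that pn orth[of "p ! i" "p ! j"] dist len by (simp add: u_def nth_eq_iff_index_eq)
    show "(\<Sum>i<n. u i v * u i w) = (if v = w then 1 else 0)" if "v < n" "w < n" for v w
      using sum.reindex_bij_betw[OF bij, of "\<lambda>i. U $$ (v,i) * U $$ (w,i)"] comp[OF that]
      by (simp add: u_def)
    show "mat_app n M (u i) v = e i * u i v" if "i < n" "v < n" for i v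
      using eig[OF that(2) pn[OF that(1)]] by (simp add: mat_app_def u_def e_def)
    show "\<bar>e j\<bar> \<le> \<bar>e i\<bar>" if "i \<le> j" "j < n" for i j
      using sorted_nth_mono[OF sp that(1)] that len by (simp add: e_def)
  qed (use sym in auto)
  have "similar_mat ?A D"
    by (rule similar_matI[of _ _ U "transpose_mat U"]) (use U D UU UU' AU in auto)
  then have "char_poly ?A = char_poly D" by (rule char_poly_similar)
  also have "\<dots> = (\<Prod>a\<leftarrow>diag_mat D. [:- a, 1:])"
    using D by (intro char_poly_upper_triangular[of _ n]) (auto simp: diagonal_mat_def)
  finally have cp: "char_poly ?A = (\<Prod>a\<leftarrow>diag_mat D. [:- a, 1:])" .
  have "proots (char_poly ?A) = mset (map d [0..<n])"
    unfolding cp proots_linear_factors using D by (simp add: diag_mat_def d_def[abs_def])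
  then have "image_mset abs (proots (char_poly ?A)) = image_mset (\<lambda>i. \<bar>d i\<bar>) (mset [0..<n])"
    by (simp add: image_mset.compositionality comp_def)
  also have "\<dots> = image_mset (\<lambda>i. \<bar>d i\<bar>) (mset p)" by (simp only: mset)
  also have "\<dots> = mset (rev (map (\<lambda>i. \<bar>d i\<bar>) p))" by simp
  finally have ms: "image_mset abs (proots (char_poly ?A)) = mset (rev (map (\<lambda>i. \<bar>d i\<bar>) p))" .
  have "sorted (rev (map (\<lambda>i. \<bar>d i\<bar>) p))"
    using sp by (simp add: sorted_wrt_rev sorted_wrt_map)
  then have "sorted_list_of_multiset (image_mset abs (proots (char_poly ?A))) = rev (map (\<lambda>i. \<bar>d i\<bar>) p)"
    unfolding ms sorted_list_of_multiset_mset by (simp add: sorted_sort_id)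
  moreover have "map (\<lambda>i. \<bar>d i\<bar>) p = map (\<lambda>i. \<bar>e i\<bar>) [0..<n]"
    using len by (intro nth_equalityI) (auto simp: e_def)
  ultimately show thesis using that[OF basis] by simp
qed

section \<open>Subspaces expanded by a matrix\<close>

text \<open>
  By Pythagoras, if a matrix maps an orthogonal family to an orthogonal family, it stretches every
  linear combination at least as much as the least stretched member.
\<close>
lemma expands_orthogonal_family:
  assumes orth: "\<And>i j. i < k \<Longrightarrow> j < k \<Longrightarrow> i \<noteq> j \<Longrightarrow> (\<Sum>v<n. X i v * X j v) = 0"
    and pos: "\<And>i. i < k \<Longrightarrow> 0 < (\<Sum>v<n. (X i v)\<^sup>2)"
    and image: "\<And>i v. i < k \<Longrightarrow> v < n \<Longrightarrow> mat_app n M (X i) v = Y i v"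
    and orthY: "\<And>i j. i < k \<Longrightarrow> j < k \<Longrightarrow> i \<noteq> j \<Longrightarrow> (\<Sum>v<n. Y i v * Y j v) = 0"
    and stretch: "\<And>i. i < k \<Longrightarrow> c\<^sup>2 * (\<Sum>v<n. (X i v)\<^sup>2) \<le> (\<Sum>v<n. (Y i v)\<^sup>2)"
  shows "expands n M k c"
proof -
  have pyth: "(\<Sum>v<n. (lincomb k Z a v)\<^sup>2) = (\<Sum>i<k. (a i)\<^sup>2 * (\<Sum>v<n. (Z i v)\<^sup>2))"
    if Z: "\<And>i j. i < k \<Longrightarrow> j < k \<Longrightarrow> i \<noteq> j \<Longrightarrow> (\<Sum>v<n. Z i v * Z j v) = 0" for Z a
  proof -
    have "(\<Sum>v<n. (lincomb k Z a v)\<^sup>2) = (\<Sum>v<n. \<Sum>i<k. \<Sum>j<k. a i * a j * (Z i v * Z j v))"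
      by (simp add: lincomb_def power2_eq_square sum_product mult_ac)
    also have "\<dots> = (\<Sum>i<k. \<Sum>v<n. \<Sum>j<k. a i * a j * (Z i v * Z j v))"
      by (rule sum.swap)
    also have "\<dots> = (\<Sum>i<k. \<Sum>j<k. \<Sum>v<n. a i * a j * (Z i v * Z j v))"
      by (intro sum.cong refl sum.swap)
    also have "\<dots> = (\<Sum>i<k. \<Sum>j<k. a i * a j * (\<Sum>v<n. Z i v * Z j v))"
      by (simp add: sum_distrib_left)
    also have "\<dots> = (\<Sum>i<k. \<Sum>j<k. if i = j then (a i)\<^sup>2 * (\<Sum>v<n. (Z i v)\<^sup>2) else 0)"
      by (intro sum.cong refl) (auto simp: Z power2_eq_square)
    finally show ?thesis by simp
  qed
  have pythX: "(\<Sum>v<n. (lincomb k X a v)\<^sup>2) = (\<Sum>i<k. (a i)\<^sup>2 * (\<Sum>v<n. (X i v)\<^sup>2))" for a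
    using orth by (rule pyth)
  have pythY: "(\<Sum>v<n. (lincomb k Y a v)\<^sup>2) = (\<Sum>i<k. (a i)\<^sup>2 * (\<Sum>v<n. (Y i v)\<^sup>2))" for a
    using orthY by (rule pyth)
  have lin: "mat_app n M (lincomb k X a) v = lincomb k Y a v" if "v < n" for a v
  proof -
    have "mat_app n M (lincomb k X a) v = (\<Sum>w<n. \<Sum>i<k. a i * (M v w * X i w))"
      by (simp add: mat_app_def lincomb_def sum_distrib_left mult_ac)
    also have "\<dots> = (\<Sum>i<k. \<Sum>w<n. a i * (M v w * X i w))"
      by (rule sum.swap)
    also have "\<dots> = (\<Sum>i<k. a i * mat_app n M (X i) v)"
      by (simp add: mat_app_def sum_distrib_left)
    finally show ?thesis using that by (simp add: lincomb_def image)
  qed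
  show ?thesis
    unfolding expands_def
  proof (intro exI[of _ X] allI impI conjI)
    fix a :: "nat \<Rightarrow> real" assume "\<exists>i<k. a i \<noteq> 0"
    then obtain i0 where i0: "i0 < k" "a i0 \<noteq> 0" by blast
    have "0 < (\<Sum>v<n. (lincomb k X a v)\<^sup>2)"
      unfolding pythX using i0 pos
      by (intro sum_pos2[of _ i0]) (auto intro!: mult_nonneg_nonneg sum_nonneg)
    then show "0 < L2_set (lincomb k X a) {..<n}" by (simp add: L2_set_def)
    have "(c * L2_set (lincomb k X a) {..<n})\<^sup>2 = (\<Sum>i<k. (a i)\<^sup>2 * (c\<^sup>2 * (\<Sum>v<n. (X i v)\<^sup>2)))"
      by (simp add: power_mult_distrib L2_set_sq pythX sum_distrib_left mult_ac)
    also have "\<dots> \<le> (\<Sum>i<k. (a i)\<^sup>2 * (\<Sum>v<n. (Y i v)\<^sup>2))"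
      using stretch by (intro sum_mono mult_left_mono) auto
    also have "\<dots> = (L2_set (mat_app n M (lincomb k X a)) {..<n})\<^sup>2"
      by (simp add: L2_set_sq lin pythY)
    finally show "c * L2_set (lincomb k X a) {..<n} \<le> L2_set (mat_app n M (lincomb k X a)) {..<n}"
      by (rule power2_le_imp_le) (simp add: L2_set_nonneg)
  qed
qed

text \<open>
  For vectors that vanish outside the first \<open>n\<close> coordinates, the larger matrix only adds further
  coordinates to the image. The case \<open>m = n\<close> says that only the entries inside the index range
  matter.
\<close>
lemma expands_extend:
  assumes nm: "n \<le> m" and agree: "\<And>v w. v < n \<Longrightarrow> w < n \<Longrightarrow> M' v w = M v w"
    and ex: "expands n M k c"
  shows "expands m M' k c"
proof -
  obtain X where X: "\<And>a. \<exists>i<k. a i \<noteq> 0 \<Longrightarrow> 0 < L2_set (lincomb k X a) {..<n} \<and>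
     c * L2_set (lincomb k X a) {..<n} \<le> L2_set (mat_app n M (lincomb k X a)) {..<n}"
    using ex unfolding expands_def by blast
  define X' where "X' i v = (if v < n then X i v else 0)" for i v
  have lc: "lincomb k X' a v = (if v < n then lincomb k X a v else 0)" for a v
    by (simp add: lincomb_def X'_def)
  have norm: "L2_set (lincomb k X' a) {..<m} = L2_set (lincomb k X a) {..<n}" for a
  proof -
    have "(\<Sum>v<m. (lincomb k X' a v)\<^sup>2) = (\<Sum>v<n. (lincomb k X a v)\<^sup>2)"
      using nm by (intro sum.mono_neutral_cong_right) (auto simp: lc)
    then show ?thesis by (simp add: L2_set_def)
  qed
  have app: "mat_app m M' (lincomb k X' a) v = mat_app n M (lincomb k X a) v" if "v < n" for a v
    unfolding mat_app_def
    using nm that by (intro sum.mono_neutral_cong_right) (auto simp: lc agree)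
  have "L2_set (mat_app n M (lincomb k X a)) {..<n} \<le> L2_set (mat_app m M' (lincomb k X' a)) {..<m}" for a
  proof -
    have "(\<Sum>v<n. (mat_app n M (lincomb k X a) v)\<^sup>2) = (\<Sum>v<n. (mat_app m M' (lincomb k X' a) v)\<^sup>2)"
      by (simp add: app)
    also have "\<dots> \<le> (\<Sum>v<m. (mat_app m M' (lincomb k X' a) v)\<^sup>2)"
      using nm by (intro sum_mono2) auto
    finally show ?thesis by (simp add: L2_set_def)
  qed
  then show ?thesis
    unfolding expands_def using X by (intro exI[of _ X']) (auto simp: norm intro: order_trans)
qed

text \<open>Division with remainder identifies \<open>{..<t * n}\<close> with \<open>{..<t} \<times> {..<n}\<close>.\<close>
lemma sum_div_mod:
  "(\<Sum>v<t * n. F (v div n) (v mod n)) = (\<Sum>p<t. \<Sum>b<n. F p b)" for F :: "nat \<Rightarrow> nat \<Rightarrow> 'a::comm_monoid_add"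
proof (cases "n = 0")
  case False
  have "(\<Sum>v<t * n. F (v div n) (v mod n)) = (\<Sum>p<t. \<Sum>v=p*n..<p*n+n. F (v div n) (v mod n))"
    by (rule sum.nat_group[symmetric])
  also have "\<dots> = (\<Sum>p<t. \<Sum>b<n. F p b)"
  proof (rule sum.cong[OF refl])
    fix p
    have "(\<Sum>v=p*n..<p*n+n. F (v div n) (v mod n)) = (\<Sum>b=0..<n. F ((b + p*n) div n) ((b + p*n) mod n))"
      using sum.shift_bounds_nat_ivl[of "\<lambda>v. F (v div n) (v mod n)" 0 "p*n" n] by (simp add: add.commute)
    also have "\<dots> = (\<Sum>b<n. F p b)"
      using False by (intro sum.cong) auto
    finally show "(\<Sum>v=p*n..<p*n+n. F (v div n) (v mod n)) = (\<Sum>b<n. F p b)" .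
  qed
  finally show ?thesis .
qed simp

lemma sum_periodic: "(\<Sum>v<t * n. f (v mod n)) = real t * (\<Sum>b<n. f b)" for f :: "nat \<Rightarrow> real"
  using sum_div_mod[of "\<lambda>_. f" n t] by simp

text \<open>
  Index \<open>v\<close> is a copy of \<open>v mod n\<close>.  On vectors that are constant on the copies, the blow-up
  multiplies the image by \<open>t\<close>, and the entries \<open>b\<close> between distinct copies of the same index
  contribute \<open>b * (t - 1)\<close> times the identity.  The value \<open>b = 0\<close> serves for a graph whose
  vertices become independent sets, and \<open>b = 1\<close> for its complement, where they become cliques.
\<close>
lemma expands_blowup:
  assumes n: "n > 0" and t: "t > 0" and b: "b \<ge> 0" and ex: "expands n M k c"
    and M': "\<And>v w. v < t * n \<Longrightarrow> w < t * n \<Longrightarrow>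
       M' v w = M (v mod n) (w mod n) + (if v \<noteq> w \<and> v mod n = w mod n then b else 0)"
  shows "expands (t * n) M' k (t * c - b * (real t - 1))"
proof -
  obtain X where X: "\<And>a. \<exists>i<k. a i \<noteq> 0 \<Longrightarrow> 0 < L2_set (lincomb k X a) {..<n} \<and>
     c * L2_set (lincomb k X a) {..<n} \<le> L2_set (mat_app n M (lincomb k X a)) {..<n}"
    using ex unfolding expands_def by blast
  define X' where "X' i v = X i (v mod n)" for i v
  have norm: "L2_set (\<lambda>v. f (v mod n)) {..<t * n} = sqrt t * L2_set f {..<n}" for f
    unfolding L2_set_def using sum_periodic[of "\<lambda>v. (f v)\<^sup>2" n t] by (simp add: real_sqrt_mult)
  have lc: "lincomb k X' a = (\<lambda>v. lincomb k X a (v mod n))" for a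
    by (intro ext) (simp add: lincomb_def X'_def)
  have bt: "b * (real t - 1) \<ge> 0" using b t by simp
  have main: "0 < L2_set (lincomb k X' a) {..<t * n} \<and>
     (t * c - b * (real t - 1)) * L2_set (lincomb k X' a) {..<t * n} \<le> L2_set (mat_app (t * n) M' (lincomb k X' a)) {..<t * n}"
    if a: "\<exists>i<k. a i \<noteq> 0" for a
  proof -
    define x where "x = lincomb k X a"
    define y where "y = mat_app n M x"
    have app: "mat_app (t * n) M' (lincomb k X' a) v = t * y (v mod n) + b * (real t - 1) * x (v mod n)"
      if v: "v < t * n" for v
    proof -
      have "mat_app (t * n) M' (lincomb k X' a) v
        = (\<Sum>w<t * n. M (v mod n) (w mod n) * x (w mod n) + b * (if v mod n = w mod n then x (w mod n) else 0)
             - (if w = v then b * x (v mod n) else 0))"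
        unfolding mat_app_def by (intro sum.cong refl) (use v in \<open>auto simp: M' lc x_def algebra_simps\<close>)
      also have "\<dots> = t * y (v mod n) + b * (t * x (v mod n)) - b * x (v mod n)"
        using v n sum_periodic[of "\<lambda>w. M (v mod n) w * x w" n t]
          sum_periodic[of "\<lambda>w. if v mod n = w then x w else 0" n t]
        by (simp add: sum.distrib sum_subtractf y_def mat_app_def flip: sum_distrib_left)
      finally show ?thesis by (simp add: algebra_simps)
    qed
    have "t * (sqrt t * L2_set y {..<n}) = L2_set (\<lambda>v. t * y (v mod n)) {..<t * n}"
      by (simp add: norm[of y, symmetric] L2_set_right_distrib)
    also have "\<dots> = L2_set (\<lambda>v. mat_app (t * n) M' (lincomb k X' a) v + (- (b * (real t - 1))) * x (v mod n)) {..<t * n}"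
      by (intro L2_set_cong) (auto simp: app)
    also have "\<dots> \<le> L2_set (mat_app (t * n) M' (lincomb k X' a)) {..<t * n}
        + L2_set (\<lambda>v. (- (b * (real t - 1))) * x (v mod n)) {..<t * n}"
      by (rule L2_set_triangle_ineq)
    also have "L2_set (\<lambda>v. (- (b * (real t - 1))) * x (v mod n)) {..<t * n}
       = L2_set (\<lambda>v. (b * (real t - 1)) * x (v mod n)) {..<t * n}"
      by (simp add: L2_set_def power_mult_distrib)
    also have "\<dots> = b * (real t - 1) * (sqrt t * L2_set x {..<n})"
      using bt by (simp add: norm[of x, symmetric] L2_set_right_distrib)
    finally have 1: "t * (sqrt t * L2_set y {..<n}) - b * (real t - 1) * (sqrt t * L2_set x {..<n})
       \<le> L2_set (mat_app (t * n) M' (lincomb k X' a)) {..<t * n}" by simp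
    have "t * sqrt t * (c * L2_set x {..<n}) \<le> t * sqrt t * L2_set y {..<n}"
      using X[OF a] unfolding x_def y_def by (intro mult_left_mono) auto
    with 1 have "(t * c - b * (real t - 1)) * (sqrt t * L2_set x {..<n}) \<le> L2_set (mat_app (t * n) M' (lincomb k X' a)) {..<t * n}"
      by (simp add: algebra_simps)
    then show ?thesis
      using X[OF a] t norm[of x] unfolding x_def by (simp add: lc)
  qed
  then show ?thesis unfolding expands_def by blast
qed

text \<open>The triangle inequality: the identity matrix changes the norm of an image by at most that of the vector.\<close>
lemma expands_minus_identity:
  assumes ex: "expands n M k c" and M': "\<And>v w. v < n \<Longrightarrow> w < n \<Longrightarrow> M' v w = M v w - (if v = w then 1 else 0)"
  shows "expands n M' k (c - 1)"
proof -
  obtain X where X: "\<And>a. \<exists>i<k. a i \<noteq> 0 \<Longrightarrow> 0 < L2_set (lincomb k X a) {..<n} \<and>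
     c * L2_set (lincomb k X a) {..<n} \<le> L2_set (mat_app n M (lincomb k X a)) {..<n}"
    using ex unfolding expands_def by blast
  have app: "mat_app n M x v = mat_app n M' x v + x v" if "v < n" for x v
  proof -
    have "mat_app n M' x v = (\<Sum>w<n. M v w * x w - (if v = w then x w else 0))"
      unfolding mat_app_def by (intro sum.cong refl) (use that in \<open>auto simp: M' algebra_simps\<close>)
    then show ?thesis using that by (simp add: mat_app_def sum_subtractf)
  qed
  have "L2_set (mat_app n M x) {..<n} \<le> L2_set (mat_app n M' x) {..<n} + L2_set x {..<n}" for x
  proof -
    have "L2_set (mat_app n M x) {..<n} = L2_set (\<lambda>v. mat_app n M' x v + x v) {..<n}"
      by (intro L2_set_cong) (auto simp: app)
    then show ?thesis using L2_set_triangle_ineq[of "mat_app n M' x" x "{..<n}"] by simp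
  qed
  note tri = this
  show ?thesis
    unfolding expands_def
  proof (intro exI[of _ X] allI impI)
    fix a :: "nat \<Rightarrow> real" assume a: "\<exists>i<k. a i \<noteq> 0"
    show "0 < L2_set (lincomb k X a) {..<n} \<and>
      (c - 1) * L2_set (lincomb k X a) {..<n} \<le> L2_set (mat_app n M' (lincomb k X a)) {..<n}"
      using X[OF a] tri[of "lincomb k X a"] by (simp add: left_diff_distrib)
  qed
qed

section \<open>Singular values of graphs\<close>

definition adj :: "nat set set \<Rightarrow> nat \<Rightarrow> nat \<Rightarrow> real" where
  "adj E v w = (if {v, w} \<in> E then 1 else 0)"

lemma adjacency_eigenbasis:
  obtains u e where "sorted_eigenbasis n (adj E) u e"
    "\<And>k. 1 \<le> k \<Longrightarrow> k \<le> n \<Longrightarrow> singular_value k n E = \<bar>e (k - 1)\<bar>"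
proof -
  have "adj E v w = adj E w v" for v w by (simp add: adj_def insert_commute)
  then obtain u e where *: "sorted_eigenbasis n (adj E) u e"
    "rev (sorted_list_of_multiset (image_mset abs (proots (char_poly (mat n n (\<lambda>(i,j). adj E i j))))))
       = map (\<lambda>i. \<bar>e i\<bar>) [0..<n]"
    by (rule sorted_eigenbasis_exists[of n "adj E"]) blast
  show thesis
  proof (rule that[OF *(1)])
    fix k :: nat assume k: "1 \<le> k" "k \<le> n"
    have "adjacency_matrix n E = mat n n (\<lambda>(i,j). adj E i j)"
      by (simp add: adjacency_matrix_def adj_def)
    then show "singular_value k n E = \<bar>e (k - 1)\<bar>"
      using k nth_upt[of 0 "k - 1" n] by (simp add: singular_value_def adjacency_eigenvalues_def *(2))
  qed
qed

lemma singular_value_ge_iff: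
  assumes "1 \<le> k" "k \<le> n"
  shows "c \<le> singular_value k n E \<longleftrightarrow> expands n (adj E) k c"
  using adjacency_eigenbasis[of n E] sorted_eigenbasis.courant_fischer[OF _ assms] assms by metis

text \<open>
  With \<open>S\<close> the sum of all entries: the squares of the eigenvalues sum to \<open>S\<close>, the Cauchy--Schwarz
  inequality for the row sums and the all-ones vector bounds the largest modulus below by \<open>S / n\<close>,
  and \<open>S - (S / n)\<^sup>2 \<le> (n / 2)\<^sup>2\<close> for every real \<open>S\<close>.
\<close>
lemma singular_value_le:
  assumes k: "2 \<le> k" "k \<le> n"
  shows "singular_value k n E \<le> n / (2 * sqrt (real k - 1))"
proof -
  obtain u e where basis: "sorted_eigenbasis n (adj E) u e"
    and sv: "\<And>k. 1 \<le> k \<Longrightarrow> k \<le> n \<Longrightarrow> singular_value k n E = \<bar>e (k - 1)\<bar>"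
    using adjacency_eigenbasis[of n E] by metis
  interpret sorted_eigenbasis n "adj E" u e by (rule basis)
  have n: "n > 0" using k by simp
  define S where "S = (\<Sum>v<n. \<Sum>w<n. adj E v w)"
  have "S = (\<Sum>v<n. \<Sum>w<n. (adj E v w)\<^sup>2)"
    unfolding S_def by (intro sum.cong refl) (simp add: adj_def)
  then have S: "S = (\<Sum>i<n. (e i)\<^sup>2)" by (simp add: frobenius)
  have one: "L2_set (\<lambda>_. 1) {..<n} = sqrt n" by (simp add: L2_set_def)
  have "S = (\<Sum>v<n. \<bar>mat_app n (adj E) (\<lambda>_. 1) v\<bar> * \<bar>1\<bar>)"
    unfolding S_def mat_app_def by (intro sum.cong refl) (simp add: adj_def sum_nonneg)
  also have "\<dots> \<le> L2_set (mat_app n (adj E) (\<lambda>_. 1)) {..<n} * L2_set (\<lambda>_. 1) {..<n}"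
    by (rule L2_set_mult_ineq)
  also have "\<dots> \<le> \<bar>e 0\<bar> * L2_set (\<lambda>_. 1) {..<n} * L2_set (\<lambda>_. 1) {..<n}"
    by (intro mult_right_mono norm_mat_app_le L2_set_nonneg)
  also have "\<dots> = n * \<bar>e 0\<bar>" by (simp add: one)
  finally have "S / n \<le> \<bar>e 0\<bar>" using n by (simp add: field_simps)
  moreover have "0 \<le> S / n" unfolding S by (simp add: sum_nonneg)
  ultimately have e0: "(S / n)\<^sup>2 \<le> (e 0)\<^sup>2" by (simp add: abs_le_square_iff[symmetric])
  have "(real k - 1) * (e (k - 1))\<^sup>2 = (\<Sum>i\<in>{1..<k}. (e (k - 1))\<^sup>2)"
    using k by (simp add: of_nat_diff)
  also have "\<dots> \<le> (\<Sum>i\<in>{1..<k}. (e i)\<^sup>2)"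
    using decreasing k by (intro sum_mono) (auto simp flip: abs_le_square_iff)
  finally have "(S / n)\<^sup>2 + (real k - 1) * (e (k - 1))\<^sup>2 \<le> (e 0)\<^sup>2 + (\<Sum>i\<in>{1..<k}. (e i)\<^sup>2)"
    using e0 by simp
  also have "\<dots> = (\<Sum>i\<in>insert 0 {1..<k}. (e i)\<^sup>2)" by simp
  also have "\<dots> \<le> S"
    unfolding S using k by (intro sum_mono2) auto
  finally have "(real k - 1) * (e (k - 1))\<^sup>2 \<le> S - (S / n)\<^sup>2" by simp
  also have "\<dots> \<le> (n / 2)\<^sup>2"
    using zero_le_power2[of "n / 2 - S / n"] n by (simp add: power2_diff)
  finally have "(e (k - 1))\<^sup>2 \<le> (n / 2)\<^sup>2 / (real k - 1)"
    using k by (simp add: pos_le_divide_eq mult.commute)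
  also have "\<dots> = (n / (2 * sqrt (real k - 1)))\<^sup>2"
    using k by (simp add: power_divide power_mult_distrib)
  finally have "\<bar>e (k - 1)\<bar> \<le> n / (2 * sqrt (real k - 1))"
    using k by (simp add: abs_le_square_iff[symmetric])
  then show ?thesis using sv[of k] k by simp
qed

lemma edge_in_all_pairs: "{v, w} \<in> all_pairs n \<longleftrightarrow> v < n \<and> w < n \<and> v \<noteq> w"
  by (auto simp: all_pairs_def card_2_iff doubleton_eq_iff)

section \<open>Growth of the extremal function\<close>

lemma finite_graphs_of_order: "finite (graphs_of_order n)"
proof -
  have "all_pairs n \<subseteq> Pow {..<n}" by (auto simp: all_pairs_def)
  then have "finite (all_pairs n)" by (rule finite_subset) simp
  moreover have "graphs_of_order n = Pow (all_pairs n)" by (auto simp: graphs_of_order_def)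
  ultimately show ?thesis by simp
qed

lemma f_star_n_ge:
  assumes "E \<in> graphs_of_order n"
  shows "singular_value k n E + singular_value k n (complement_graph n E) \<le> f_star_n k n"
  unfolding f_star_n_def using assms finite_graphs_of_order by (intro Max_ge) auto

lemma f_star_n_attained:
  obtains E where "E \<in> graphs_of_order n"
    "f_star_n k n = singular_value k n E + singular_value k n (complement_graph n E)"
proof -
  have "{} \<in> graphs_of_order n" by (simp add: graphs_of_order_def)
  then have "f_star_n k n \<in> (\<lambda>E. singular_value k n E + singular_value k n (complement_graph n E)) ` graphs_of_order n"
    unfolding f_star_n_def using finite_graphs_of_order by (intro Max_in) auto
  then show thesis using that by blast
qed

lemma f_star_n_le:
  assumes "2 \<le> k" "k \<le> n"
  shows "f_star_n k n \<le> n / sqrt (real k - 1)"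
proof -
  obtain E where "f_star_n k n = singular_value k n E + singular_value k n (complement_graph n E)"
    by (rule f_star_n_attained)
  then show ?thesis
    using singular_value_le[OF assms, of E] singular_value_le[OF assms, of "complement_graph n E"] by simp
qed

text \<open>
  Adding isolated vertices to an optimal graph leaves the old graph and the old complement in
  place as induced subgraphs.
\<close>
lemma f_star_n_mono:
  assumes "1 \<le> k" "k \<le> n" "n \<le> m"
  shows "f_star_n k n \<le> f_star_n k m"
proof -
  obtain E where E: "E \<in> graphs_of_order n"
    and f: "f_star_n k n = singular_value k n E + singular_value k n (complement_graph n E)"
    by (rule f_star_n_attained)
  have k: "1 \<le> k" "k \<le> m" using assms by auto
  have mono: "singular_value k n F \<le> singular_value k m F'"
    if "\<And>v w. v < n \<Longrightarrow> w < n \<Longrightarrow> adj F' v w = adj F v w" for F F'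
    unfolding singular_value_ge_iff[OF k]
    using assms(3) that by (rule expands_extend) (simp_all flip: singular_value_ge_iff[OF assms(1,2)])
  have "singular_value k n E \<le> singular_value k m E" by (rule mono) simp
  moreover have "singular_value k n (complement_graph n E) \<le> singular_value k m (complement_graph m E)"
    using assms(3) by (intro mono) (simp add: adj_def complement_graph_def edge_in_all_pairs)
  moreover have "E \<in> graphs_of_order m"
    using E assms(3) unfolding graphs_of_order_def all_pairs_def by fastforce
  ultimately show ?thesis using f_star_n_ge[of E m k] f by simp
qed

text \<open>
  Each vertex of an optimal graph is replaced by an independent set of size \<open>t\<close>.  The copies of a
  vertex form a clique in the complement, which costs at most \<open>t - 1\<close> in the singular value.
\<close>
lemma f_star_n_blowup:
  assumes k: "1 \<le> k" "k \<le> n" and t: "t > 0"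
  shows "t * f_star_n k n - t \<le> f_star_n k (t * n)"
proof -
  obtain E where E: "E \<in> graphs_of_order n"
    and f: "f_star_n k n = singular_value k n E + singular_value k n (complement_graph n E)"
    by (rule f_star_n_attained)
  have n: "n > 0" using k by simp
  have k': "1 \<le> k" "k \<le> t * n"
    using k t mult_le_mono[of 1 t k n] by auto
  define F where "F = {{v, w} |v w. v < t * n \<and> w < t * n \<and> {v mod n, w mod n} \<in> E}"
  have F: "{v, w} \<in> F \<longleftrightarrow> v < t * n \<and> w < t * n \<and> {v mod n, w mod n} \<in> E" for v w
    by (auto simp: F_def doubleton_eq_iff insert_commute)
  have E': "x \<noteq> y" if "{x, y} \<in> E" for x y
    using that E edge_in_all_pairs[of x y n] by (auto simp: graphs_of_order_def)
  have "F \<in> graphs_of_order (t * n)"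
    unfolding graphs_of_order_def
  proof (safe)
    fix e assume e: "e \<in> F"
    then obtain v w where "e = {v, w}" unfolding F_def by blast
    then show "e \<in> all_pairs (t * n)" using e F[of v w] E' by (auto simp: edge_in_all_pairs)
  qed
  note F_graph = this
  have "expands (t * n) (adj F) k (t * singular_value k n E - 0 * (real t - 1))"
    by (rule expands_blowup[of n t 0 "adj E"])
      (use n t k in \<open>auto simp: F adj_def simp flip: singular_value_ge_iff\<close>)
  then have 1: "t * singular_value k n E \<le> singular_value k (t * n) F"
    by (simp add: singular_value_ge_iff[OF k'])
  have "expands (t * n) (adj (complement_graph (t * n) F)) k (t * singular_value k n (complement_graph n E) - 1 * (real t - 1))"
  proof (rule expands_blowup[of n t 1 "adj (complement_graph n E)"])
    show "expands n (adj (complement_graph n E)) k (singular_value k n (complement_graph n E))"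
      by (simp flip: singular_value_ge_iff[OF k])
    fix v w assume "v < t * n" "w < t * n"
    then show "adj (complement_graph (t * n) F) v w = adj (complement_graph n E) (v mod n) (w mod n)
      + (if v \<noteq> w \<and> v mod n = w mod n then 1 else 0)"
      using n E'[of "v mod n" "w mod n"] by (auto simp: adj_def complement_graph_def edge_in_all_pairs F)
  qed (use n t in auto)
  then have "t * singular_value k n (complement_graph n E) - (real t - 1) \<le> singular_value k (t * n) (complement_graph (t * n) F)"
    by (simp add: singular_value_ge_iff[OF k'])
  with 1 show ?thesis using f_star_n_ge[OF F_graph, of k] f t by (simp add: algebra_simps)
qed

text \<open>
  Fekete's argument.  The limit is the supremum of \<open>g n = (f n - 1) / n\<close>: for large \<open>m\<close>,
  comparison of \<open>m\<close> with the largest multiple \<open>t * n\<close> below it gives \<open>f m \<ge> t * (f n - 1)\<close>, while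
  \<open>f n / n\<close> exceeds \<open>g n\<close> by \<open>1 / n\<close> only.  The lower bounds \<open>g n\<close> on the limit let explicit
  graphs of single orders bound it.
\<close>
lemma almost_superadditive_ratio_converges:
  fixes f :: "nat \<Rightarrow> real" and C :: real
  assumes mono: "\<And>n m. k \<le> n \<Longrightarrow> n \<le> m \<Longrightarrow> f n \<le> f m"
    and blowup: "\<And>n t. k \<le> n \<Longrightarrow> t > 0 \<Longrightarrow> real t * f n - real t \<le> f (t * n)"
    and bound: "\<And>n. k \<le> n \<Longrightarrow> f n \<le> C * n" and k: "k > 0"
  obtains L where "(\<lambda>n. f n / n) \<longlonglongrightarrow> L" "\<And>n. k \<le> n \<Longrightarrow> (f n - 1) / n \<le> L"
proof -
  define g where "g n = (f n - 1) / n" for n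
  define L where "L = (SUP n\<in>{k..}. g n)"
  have gC: "g n \<le> C" if "n \<ge> k" for n
    using bound[OF that] k that by (simp add: g_def divide_le_eq)
  have bdd: "bdd_above (g ` {k..})" by (rule bdd_aboveI[of _ C]) (auto intro: gC)
  have gL: "g n \<le> L" if "n \<ge> k" for n
    unfolding L_def using bdd that by (intro cSUP_upper) auto
  have low: "f m / m \<ge> g n - \<bar>g n\<bar> * n / m" if nm: "k \<le> n" "n \<le> m" for n m
  proof -
    define t where "t = m div n"
    have n: "n > 0" using nm k by simp
    have t: "t > 0" using nm n by (simp add: t_def div_greater_zero_iff)
    have tm: "t * n \<le> m" by (simp add: t_def)
    have mt: "m < t * n + n" unfolding t_def using dividend_less_div_times[OF n, of m] by simp
    have "t * n * g n = t * f n - t" using n by (simp add: g_def field_simps)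
    also have "\<dots> \<le> f (t * n)" using blowup[OF nm(1) t] .
    also have "\<dots> \<le> f m" using mono[of "t * n" m] tm nm t
      by (metis One_nat_def Suc_leI le_trans mult_le_mono1 mult_1)
    finally have 1: "t * n * g n \<le> f m" .
    have "m * g n - t * n * g n = (real m - real t * real n) * g n" by (simp add: algebra_simps)
    also have "\<dots> \<le> (real m - real t * real n) * \<bar>g n\<bar>"
      using tm by (intro mult_left_mono) (auto simp flip: of_nat_mult)
    also have "\<dots> \<le> n * \<bar>g n\<bar>"
    proof (rule mult_right_mono)
      have "real m \<le> real (t * n + n)" using mt by linarith
      then show "real m - real t * real n \<le> real n" by simp
    qed simp
    finally have "m * g n - \<bar>g n\<bar> * n \<le> f m" using 1 by (simp add: mult.commute)
    then have "(m * g n - \<bar>g n\<bar> * n) / m \<le> f m / m" by (rule divide_right_mono) simp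
    moreover have "m > 0" using nm n by simp
    ultimately show ?thesis by (simp add: diff_divide_distrib)
  qed
  have "(\<lambda>n. f n / n) \<longlonglongrightarrow> L"
  proof (rule order_tendstoI)
    fix a assume "a < L"
    then obtain n where n: "n \<ge> k" "a < g n"
      using less_cSUP_iff[OF _ bdd, of a] by (auto simp: L_def)
    have "(\<lambda>m. g n - \<bar>g n\<bar> * n / m) \<longlonglongrightarrow> g n - 0"
      by (intro tendsto_diff tendsto_const lim_const_over_n)
    then have "eventually (\<lambda>m. a < g n - \<bar>g n\<bar> * n / m) sequentially"
      using n by (intro order_tendstoD) auto
    moreover have "eventually (\<lambda>m. m \<ge> n) sequentially" by (rule eventually_ge_at_top)
    ultimately show "eventually (\<lambda>m. a < f m / m) sequentially"
    proof eventually_elim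
      case (elim m)
      then show ?case using low[of n m] n by simp
    qed
  next
    fix a assume a: "L < a"
    have "(\<lambda>m. L + 1 / real m) \<longlonglongrightarrow> L + 0"
      by (intro tendsto_add tendsto_const lim_const_over_n)
    then have "eventually (\<lambda>m. L + 1 / real m < a) sequentially"
      using a by (intro order_tendstoD) auto
    moreover have "eventually (\<lambda>m. m \<ge> k) sequentially" by (rule eventually_ge_at_top)
    ultimately show "eventually (\<lambda>m. f m / m < a) sequentially"
    proof eventually_elim
      case (elim m)
      then show ?case using gL[of m] by (simp add: g_def diff_divide_distrib)
    qed
  qed
  then show thesis using that gL by (simp add: g_def)
qed

section \<open>Kharaghani matrices\<close>

text \<open>The sign is determined by bit number \<open>a\<close> of \<open>b\<close>.\<close>
definition rademacher :: "nat \<Rightarrow> nat \<Rightarrow> real" where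
  "rademacher a b = (- 1) ^ (b div 2 ^ a)"

lemma rademacher_sq [simp]: "rademacher a b * rademacher a b = 1"
  by (simp add: rademacher_def flip: power_mult_distrib)

text \<open>
  Below position \<open>j\<close>, the binary digits of \<open>b\<close> are those of \<open>b mod 2 ^ j\<close>.  This splits sums over
  \<open>{..<2 ^ Suc j}\<close> into two equal halves when only lower bits occur; the top bit changes sign
  between the halves.
\<close>
lemma rademacher_mod:
  assumes a: "a < j"
  shows "rademacher a b = rademacher a (b mod 2 ^ j)"
proof -
  have pow: "2 ^ j = 2 ^ (j - a) * (2 :: nat) ^ a" using a by (simp flip: power_add)
  have "b div 2 ^ a = (b mod 2 ^ j + (b div 2 ^ j * 2 ^ (j - a)) * 2 ^ a) div 2 ^ a"
    by (simp only: mult.assoc pow[symmetric] mod_div_mult_eq)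
  also have "\<dots> = b div 2 ^ j * 2 ^ (j - a) + (b mod 2 ^ j) div 2 ^ a"
    by (rule div_mult_self1) simp
  finally have "b div 2 ^ a = b div 2 ^ j * 2 ^ (j - a) + (b mod 2 ^ j) div 2 ^ a" .
  moreover have "even (b div 2 ^ j * 2 ^ (j - a))" using a by simp
  ultimately show "rademacher a b = rademacher a (b mod 2 ^ j)"
    by (simp add: rademacher_def power_add)
qed

lemma sum_rademacher: "a < j \<Longrightarrow> (\<Sum>b<2 ^ j. rademacher a b) = 0"
proof (induction j)
  case (Suc j)
  show ?case
  proof (cases "a = j")
    case True
    then show ?thesis
      using sum_div_mod[of "\<lambda>p b. (- 1 :: real) ^ p" "2 ^ j" 2]
      by (simp add: rademacher_def numeral_2_eq_2)
  next
    case False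
    then have a: "a < j" using Suc.prems by simp
    have "(\<Sum>b<2 ^ Suc j. rademacher a b) = (\<Sum>b<2 * 2 ^ j. rademacher a (b mod 2 ^ j))"
      by (intro sum.cong rademacher_mod[OF a]) simp
    also have "\<dots> = 2 * (\<Sum>b<2 ^ j. rademacher a b)"
      using sum_periodic[of "rademacher a" "2 ^ j" 2] by simp
    finally show ?thesis using Suc.IH[OF a] by simp
  qed
qed simp

lemma rademacher_orthogonal:
  "a < j \<Longrightarrow> c < j \<Longrightarrow> a \<noteq> c \<Longrightarrow> (\<Sum>b<2 ^ j. rademacher a b * rademacher c b) = 0"
proof (induction j)
  case (Suc j)
  have top: "(\<Sum>b<2 ^ Suc j. rademacher j b * rademacher c b) = 0" if c: "c < j" for c
  proof -
    have "(\<Sum>b<2 ^ Suc j. rademacher j b * rademacher c b)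
       = (\<Sum>b<2 * 2 ^ j. (- 1) ^ (b div 2 ^ j) * rademacher c (b mod 2 ^ j))"
      by (intro sum.cong arg_cong2[where f = "(*)"] rademacher_mod[OF c] rademacher_def) simp
    also have "\<dots> = (\<Sum>p<2. \<Sum>b<2 ^ j. (- 1) ^ p * rademacher c b)"
      by (rule sum_div_mod)
    also have "\<dots> = 0"
      using sum_rademacher[OF c] by (simp flip: sum_distrib_left)
    finally show ?thesis .
  qed
  consider "a = j" "c < j" | "c = j" "a < j" | "a < j" "c < j" using Suc.prems by linarith
  then show ?case
  proof cases
    case 1
    then show ?thesis using top by simp
  next
    case 2
    then show ?thesis using top[of a] by (simp add: mult.commute)
  next
    case 3
    have "(\<Sum>b<2 ^ Suc j. rademacher a b * rademacher c b)
       = (\<Sum>b<2 * 2 ^ j. rademacher a (b mod 2 ^ j) * rademacher c (b mod 2 ^ j))"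
      by (intro sum.cong arg_cong2[where f = "(*)"] rademacher_mod 3) simp
    also have "\<dots> = 2 * (\<Sum>b<2 ^ j. rademacher a b * rademacher c b)"
      using sum_periodic[of "\<lambda>b. rademacher a b * rademacher c b" "2 ^ j" 2] by simp
    finally show ?thesis using Suc.IH 3 Suc.prems by simp
  qed
qed simp

text \<open>The addition table of the integers modulo \<open>s\<close>, a symmetric Latin square.\<close>
definition latin :: "nat \<Rightarrow> nat \<Rightarrow> nat \<Rightarrow> nat" where
  "latin s p q = (p + q) mod s"

lemma latin_lt: "s > 0 \<Longrightarrow> latin s p q < s"
  by (simp add: latin_def)

lemma latin_commute: "latin s p q = latin s q p"
  by (simp add: latin_def add.commute)

lemma latin_cancel: "latin s p q = latin s p q' \<Longrightarrow> q < s \<Longrightarrow> q' < s \<Longrightarrow> q = q'"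
  unfolding latin_def nat_mod_eq_iff[of "p + q"] by (metis add.assoc add_left_cancel mod_less nat_mod_eq_iff)

lemma latin_surj: "a < s \<Longrightarrow> q < s \<Longrightarrow> \<exists>p<s. latin s p q = a"
  by (rule exI[of _ "(a + (s - q)) mod s"]) (auto simp: latin_def mod_simps)

text \<open>
  A block matrix with \<open>s \<times> s\<close> blocks of order \<open>h\<close>: if \<open>r\<^sub>a\<close> denotes the Rademacher vector number
  \<open>a\<close>, the block at \<open>(p, q)\<close> is \<open>r\<^sub>a r\<^sub>a\<^sup>T\<close> for the entry \<open>a\<close> of the Latin square at \<open>(p, q)\<close>.
\<close>
definition kharaghani :: "nat \<Rightarrow> nat \<Rightarrow> nat \<Rightarrow> nat \<Rightarrow> real" where
  "kharaghani s h v w =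
     rademacher (latin s (v div h) (w div h)) (v mod h) * rademacher (latin s (v div h) (w div h)) (w mod h)"

lemma kharaghani_basics:
  "kharaghani s h v w = kharaghani s h w v" "kharaghani s h v v = 1"
  "kharaghani s h v w = 1 \<or> kharaghani s h v w = -1"
proof -
  show "kharaghani s h v w = kharaghani s h w v"
    by (simp add: kharaghani_def latin_commute mult.commute)
  show "kharaghani s h v v = 1" by (simp add: kharaghani_def)
  have "rademacher a b = 1 \<or> rademacher a b = -1" for a b
    by (auto simp: rademacher_def minus_one_power_iff)
  from this[of "latin s (v div h) (w div h)" "v mod h"] this[of "latin s (v div h) (w div h)" "w mod h"]
  show "kharaghani s h v w = 1 \<or> kharaghani s h v w = -1" by (auto simp: kharaghani_def)
qed

text \<open>
  Let \<open>Z q a\<close> be the vector that equals \<open>r\<^sub>a\<close> on block \<open>q\<close> and 0 elsewhere.  By orthogonality of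
  the Rademacher vectors, the block at \<open>(p, q)\<close> annihilates \<open>r\<^sub>a\<close> unless the Latin square has
  entry \<open>a\<close> there; so \<open>Z q a\<close> is mapped to a multiple of \<open>Z p a\<close> for the one \<open>p\<close> with this entry.
  The part of the matrix coming from the all-ones matrix annihilates the \<open>Z q a\<close>, as they have
  zero sum, and acts alone on the all-ones vector, since the rows of the Kharaghani matrix have
  zero sum.  The \<open>s\<^sup>2 + 1\<close> vectors so obtained and their images are orthogonal families.
\<close>
lemma kharaghani_expands:
  fixes \<sigma> :: real
  assumes s: "s > 0" and j: "s \<le> j" and h: "h = 2 ^ j" and k: "k \<le> s\<^sup>2 + 1" and \<sigma>: "\<sigma>\<^sup>2 = 1"
  shows "expands (s * h) (\<lambda>v w. (1 + \<sigma> * kharaghani s h v w) / 2) k (h / 2)"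
proof -
  define M where "M v w = (1 + \<sigma> * kharaghani s h v w) / 2" for v w
  define Z where "Z q a v = (if v div h = q then rademacher a (v mod h) else 0)" for q a v
  \<comment> \<open>the image of \<open>Z q a\<close>\<close>
  define W where "W q a v = (if latin s (v div h) q = a then \<sigma> * h / 2 * rademacher a (v mod h) else 0)" for q a v
  have h0: "h > 0" using h by simp
  have orth: "(\<Sum>b<h. rademacher a b * rademacher c b) = (if a = c then real h else 0)" if "a < s" "c < s" for a c
    using that j rademacher_orthogonal[of a j c] h by auto
  have zero: "(\<Sum>b<h. rademacher a b) = 0" if "a < s" for a
    using that j sum_rademacher[of a j] h by simp
  have sumZ: "(\<Sum>v<s * h. Z q a v) = 0" if "a < s" for q a
    using sum_div_mod[of "\<lambda>p b. if p = q then rademacher a b else 0" h s] zero[OF that]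
    by (simp add: Z_def if_distrib cong: if_cong) (simp add: sum.If_cases)
  have ZZ: "(\<Sum>v<s * h. Z q a v * Z q' a' v) = (if q = q' \<and> a = a' then real h else 0)"
    if "q < s" "a < s" "q' < s" "a' < s" for q a q' a'
  proof -
    have "(\<Sum>v<s * h. Z q a v * Z q' a' v) =
       (\<Sum>p<s. \<Sum>b<h. if p = q \<and> p = q' then rademacher a b * rademacher a' b else 0)"
      unfolding sum_div_mod[symmetric] by (intro sum.cong) (auto simp: Z_def)
    also have "\<dots> = (\<Sum>p<s. if p = q then (if q = q' then \<Sum>b<h. rademacher a b * rademacher a' b else 0) else 0)"
      by (intro sum.cong) auto
    finally show ?thesis using that by (simp add: orth)
  qed
  have sumW: "(\<Sum>v<s * h. W q a v) = 0" if "a < s" for q a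
  proof -
    have "(\<Sum>v<s * h. W q a v) = (\<Sum>p<s. \<Sum>b<h. if latin s p q = a then \<sigma> * h / 2 * rademacher a b else 0)"
      unfolding sum_div_mod[symmetric] by (intro sum.cong) (auto simp: W_def)
    also have "\<dots> = (\<Sum>p<s. if latin s p q = a then \<sigma> * h / 2 * (\<Sum>b<h. rademacher a b) else 0)"
      by (intro sum.cong) (auto simp: sum_distrib_left)
    finally show ?thesis using zero[OF that] by simp
  qed
  have WW: "(\<Sum>v<s * h. W q a v * W q' a' v) =
      (\<Sum>p<s. if latin s p q = a \<and> latin s p q' = a' then (h / 2)\<^sup>2 * (if a = a' then real h else 0) else 0)"
    if "q < s" "a < s" "q' < s" "a' < s" for q a q' a'
  proof -
    have "(\<Sum>v<s * h. W q a v * W q' a' v) =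
       (\<Sum>p<s. \<Sum>b<h. if latin s p q = a \<and> latin s p q' = a' then \<sigma>\<^sup>2 * (h / 2)\<^sup>2 * (rademacher a b * rademacher a' b) else 0)"
      unfolding sum_div_mod[symmetric] by (intro sum.cong) (auto simp: W_def power2_eq_square)
    also have "\<dots> = (\<Sum>p<s. if latin s p q = a \<and> latin s p q' = a' then (h / 2)\<^sup>2 * (\<Sum>b<h. rademacher a b * rademacher a' b) else 0)"
      by (intro sum.cong) (auto simp: sum_distrib_left \<sigma>)
    finally show ?thesis using that by (simp only: orth)
  qed
  have HZ: "(\<Sum>w<s * h. kharaghani s h v w * Z q a w) = (if latin s (v div h) q = a then h * rademacher a (v mod h) else 0)"
    if "q < s" "a < s" for q a v
  proof -
    let ?L = "latin s (v div h) q"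
    have "(\<Sum>w<s * h. kharaghani s h v w * Z q a w) =
       (\<Sum>p<s. \<Sum>b<h. if p = q then rademacher ?L (v mod h) * (rademacher ?L b * rademacher a b) else 0)"
      unfolding sum_div_mod[symmetric] by (intro sum.cong) (auto simp: Z_def kharaghani_def)
    also have "\<dots> = (\<Sum>p<s. if p = q then rademacher ?L (v mod h) * (\<Sum>b<h. rademacher ?L b * rademacher a b) else 0)"
      by (intro sum.cong) (auto simp: sum_distrib_left)
    finally show ?thesis using that orth[OF latin_lt[OF s]] by auto
  qed
  have H1: "(\<Sum>w<s * h. kharaghani s h v w) = 0" for v
  proof -
    have "(\<Sum>w<s * h. kharaghani s h v w) =
       (\<Sum>p<s. \<Sum>b<h. rademacher (latin s (v div h) p) (v mod h) * rademacher (latin s (v div h) p) b)"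
      unfolding sum_div_mod[symmetric] by (simp add: kharaghani_def)
    also have "\<dots> = (\<Sum>p<s. rademacher (latin s (v div h) p) (v mod h) * (\<Sum>b<h. rademacher (latin s (v div h) p) b))"
      by (simp add: sum_distrib_left)
    finally show ?thesis by (simp add: zero latin_lt s)
  qed
  have MZ: "mat_app (s * h) M (Z q a) v = W q a v" if "q < s" "a < s" for q a v
  proof -
    have "mat_app (s * h) M (Z q a) v = (\<Sum>w<s * h. Z q a w) / 2 + \<sigma> / 2 * (\<Sum>w<s * h. kharaghani s h v w * Z q a w)"
      by (simp add: mat_app_def M_def sum_distrib_left sum.distrib field_simps flip: sum_divide_distrib)
    also have "\<dots> = W q a v"
      unfolding sumZ[OF that(2)] HZ[OF that] by (simp add: W_def)
    finally show ?thesis .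
  qed
  have M1: "mat_app (s * h) M (\<lambda>_. 1) v = s * h / 2" for v
  proof -
    have "mat_app (s * h) M (\<lambda>_. 1) v = (\<Sum>w<s * h. 1 / 2) + \<sigma> / 2 * (\<Sum>w<s * h. kharaghani s h v w)"
      by (simp add: mat_app_def M_def sum_distrib_left sum.distrib add_divide_distrib)
    then show ?thesis by (simp add: H1)
  qed
  \<comment> \<open>index 0 is the all-ones vector, and \<open>1 + q * s + a\<close> encodes the pair \<open>(q, a)\<close>\<close>
  define X where "X i v = (if i = 0 then 1 else Z ((i - 1) div s) ((i - 1) mod s) v)" for i v
  define Y where "Y i v = (if i = 0 then s * h / 2 else W ((i - 1) div s) ((i - 1) mod s) v)" for i v
  have idx: "(i - 1) div s < s" "(i - 1) mod s < s" if "i < k" "i \<noteq> 0" for i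
    using that k s by (auto simp: power2_eq_square less_mult_imp_div_less)
  have idx_inj: "i = i'" if "i \<noteq> 0" "i' \<noteq> 0" "(i - 1) div s = (i' - 1) div s" "(i - 1) mod s = (i' - 1) mod s" for i i'
    using that by (metis One_nat_def Suc_pred div_mod_decomp neq0_conv)
  have "expands (s * h) M k (h / 2)"
  proof (rule expands_orthogonal_family[where X = X and Y = Y])
    fix i i' assume i: "i < k" "i' < k" "i \<noteq> i'"
    have cases: "i = 0 \<and> i' \<noteq> 0 \<or> i \<noteq> 0 \<and> i' = 0 \<or> i \<noteq> 0 \<and> i' \<noteq> 0" using i by auto
    then consider "i = 0" "i' \<noteq> 0" | "i \<noteq> 0" "i' = 0" | "i \<noteq> 0" "i' \<noteq> 0" by blast
    then show "(\<Sum>v<s * h. X i v * X i' v) = 0"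
    proof cases
      case 1
      then show ?thesis using i idx[of i'] by (simp add: X_def sumZ)
    next
      case 2
      then show ?thesis using i idx[of i] by (simp add: X_def sumZ)
    next
      case 3
      have "\<not> ((i - 1) div s = (i' - 1) div s \<and> (i - 1) mod s = (i' - 1) mod s)"
        using idx_inj[OF 3] i(3) by blast
      then show ?thesis using 3 ZZ[OF idx[OF i(1) 3(1)] idx[OF i(2) 3(2)]] by (auto simp: X_def)
    qed
    from cases consider "i = 0" "i' \<noteq> 0" | "i \<noteq> 0" "i' = 0" | "i \<noteq> 0" "i' \<noteq> 0" by blast
    then show "(\<Sum>v<s * h. Y i v * Y i' v) = 0"
    proof cases
      case 1
      then have "(\<Sum>v<s * h. Y i v * Y i' v) = s * h / 2 * (\<Sum>v<s * h. W ((i' - 1) div s) ((i' - 1) mod s) v)"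
        by (simp add: Y_def sum_distrib_left)
      then show ?thesis unfolding sumW[OF idx(2)[OF i(2) 1(2)]] by simp
    next
      case 2
      then have "(\<Sum>v<s * h. Y i v * Y i' v) = s * h / 2 * (\<Sum>v<s * h. W ((i - 1) div s) ((i - 1) mod s) v)"
        by (simp add: Y_def sum_distrib_left mult.commute)
      then show ?thesis unfolding sumW[OF idx(2)[OF i(1) 2(1)]] by simp
    next
      case 3
      let ?q = "(i - 1) div s" and ?a = "(i - 1) mod s"
      let ?q' = "(i' - 1) div s" and ?a' = "(i' - 1) mod s"
      note qa = idx[OF i(1) 3(1)] idx[OF i(2) 3(2)]
      have diff: "\<not> (?q = ?q' \<and> ?a = ?a')" using idx_inj[OF 3] i(3) by blast
      have "(\<Sum>v<s * h. Y i v * Y i' v) = (\<Sum>v<s * h. W ?q ?a v * W ?q' ?a' v)"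
        using 3 by (simp add: Y_def)
      also have "\<dots> = (\<Sum>p<s. if latin s p ?q = ?a \<and> latin s p ?q' = ?a' then (h / 2)\<^sup>2 * (if ?a = ?a' then real h else 0) else 0)"
        by (rule WW[OF qa])
      also have "\<dots> = 0"
      proof (intro sum.neutral ballI)
        fix p
        have "?a \<noteq> ?a'" if "latin s p ?q = ?a" "latin s p ?q' = ?a'"
          using latin_cancel[OF _ qa(1,3), of p] diff that by metis
        then show "(if latin s p ?q = ?a \<and> latin s p ?q' = ?a' then (h / 2)\<^sup>2 * (if ?a = ?a' then real h else 0) else 0) = 0"
          by auto
      qed
      finally show ?thesis .
    qed
  next
    fix i v assume i: "i < k"
    show "mat_app (s * h) M (X i) v = Y i v"
    proof (cases "i = 0")
      case True
      then have "X i = (\<lambda>_. 1)" by (simp add: X_def fun_eq_iff)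
      then show ?thesis using True M1 by (simp add: Y_def)
    next
      case False
      then have "X i = Z ((i - 1) div s) ((i - 1) mod s)" by (simp add: X_def fun_eq_iff)
      then show ?thesis using False MZ[OF idx[OF i False], of v] by (simp add: Y_def)
    qed
  next
    fix i assume i: "i < k"
    have XX: "(\<Sum>v<s * h. (X i v)\<^sup>2) = (if i = 0 then s * h else h)"
      using idx[OF i] by (cases "i = 0") (simp_all add: X_def power2_eq_square ZZ)
    show "0 < (\<Sum>v<s * h. (X i v)\<^sup>2)"
      unfolding XX using h0 s by auto
    show "(h / 2)\<^sup>2 * (\<Sum>v<s * h. (X i v)\<^sup>2) \<le> (\<Sum>v<s * h. (Y i v)\<^sup>2)"
    proof (cases "i = 0")
      case True
      have "real h \<le> real (s * h)" using s by (simp only: of_nat_le_iff) simp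
      then have "(h / 2)\<^sup>2 \<le> (s * h / 2)\<^sup>2" by (intro power_mono) simp_all
      then have "(h / 2)\<^sup>2 * (s * h) \<le> (s * h / 2)\<^sup>2 * (s * h)" by (intro mult_right_mono) auto
      then show ?thesis unfolding XX using True by (simp add: Y_def mult_ac)
    next
      case False
      let ?q = "(i - 1) div s" and ?a = "(i - 1) mod s"
      note qa = idx[OF i False]
      obtain p where p: "p < s" "latin s p ?q = ?a" using latin_surj qa by blast
      have "(h / 2)\<^sup>2 * h \<le> (\<Sum>p<s. if latin s p ?q = ?a then (h / 2)\<^sup>2 * h else 0)"
        using member_le_sum[of p "{..<s}" "\<lambda>p. if latin s p ?q = ?a then (h / 2)\<^sup>2 * real h else 0"] p by simp
      also have "\<dots> = (\<Sum>v<s * h. W ?q ?a v * W ?q ?a v)"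
        unfolding WW[OF qa qa] by simp
      also have "\<dots> = (\<Sum>v<s * h. (Y i v)\<^sup>2)"
        using False by (simp add: Y_def power2_eq_square)
      finally show ?thesis unfolding XX using False by simp
    qed
  qed
  then show ?thesis by (simp add: M_def[abs_def])
qed

text \<open>
  Joining vertices where the Kharaghani matrix is \<open>1\<close> gives the graph; where it is \<open>-1\<close>, they are
  joined in the complement.  Its diagonal is \<open>1\<close>, so for the graph the identity matrix has to be
  subtracted, while the complement needs no correction.
\<close>
lemma f_star_n_kharaghani_ge:
  assumes s: "s > 0" and j: "s \<le> j" and k: "1 \<le> k" "k \<le> s\<^sup>2 + 1" "k \<le> s * 2 ^ j"
  shows "2 ^ j - 1 \<le> f_star_n k (s * 2 ^ j)"
proof -
  define h :: nat where "h = 2 ^ j"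
  let ?n = "s * h" and ?H = "kharaghani s h"
  have kn: "1 \<le> k" "k \<le> ?n" using k by (auto simp: h_def)
  define E where "E = {{v, w} |v w. v < ?n \<and> w < ?n \<and> v \<noteq> w \<and> ?H v w = 1}"
  have E: "{v, w} \<in> E \<longleftrightarrow> v < ?n \<and> w < ?n \<and> v \<noteq> w \<and> ?H v w = 1" for v w
    using kharaghani_basics(1)[of s h] by (auto simp: E_def doubleton_eq_iff)
  have graph: "E \<in> graphs_of_order ?n"
    unfolding graphs_of_order_def
  proof safe
    fix e assume "e \<in> E"
    then show "e \<in> all_pairs ?n" unfolding E_def using edge_in_all_pairs by auto
  qed
  have H: "?H v w \<noteq> 1 \<Longrightarrow> ?H v w = -1" for v w using kharaghani_basics(3)[of s h v w] by blast
  have "expands ?n (adj E) k (h / 2 - 1)"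
  proof (rule expands_minus_identity)
    show "expands ?n (\<lambda>v w. (1 + 1 * ?H v w) / 2) k (h / 2)"
      by (rule kharaghani_expands[OF s j h_def k(2)]) simp
    show "adj E v w = (1 + 1 * ?H v w) / 2 - (if v = w then 1 else 0)" if "v < ?n" "w < ?n" for v w
      using that H[of v w] kharaghani_basics(2)[of s h v] by (auto simp: adj_def E)
  qed
  moreover have "expands ?n (adj (complement_graph ?n E)) k (h / 2)"
  proof (rule expands_extend[OF order_refl])
    show "expands ?n (\<lambda>v w. (1 + (-1) * ?H v w) / 2) k (h / 2)"
      by (rule kharaghani_expands[OF s j h_def k(2)]) simp
    show "adj (complement_graph ?n E) v w = (1 + (-1) * ?H v w) / 2" if "v < ?n" "w < ?n" for v w
      using that H[of v w] kharaghani_basics(2)[of s h v]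
      by (auto simp: adj_def complement_graph_def edge_in_all_pairs E)
  qed
  ultimately show ?thesis
    using f_star_n_ge[OF graph, of k] kn by (simp add: h_def flip: singular_value_ge_iff)
qed

section \<open>The limit\<close>

text \<open>
  Along the orders \<open>s * 2 ^ j\<close> the Kharaghani graphs reach \<open>1 / s\<close> up to an error that vanishes as
  \<open>j\<close> grows.
\<close>
lemma f_star_bounds:
  assumes k: "k \<ge> 2"
  shows "f_star k \<le> 1 / sqrt (real k - 1)"
    and "s > 0 \<Longrightarrow> k \<le> s\<^sup>2 + 1 \<Longrightarrow> 1 / real s \<le> f_star k"
proof -
  have k1: "1 \<le> k" "0 < k" using k by auto
  obtain L where L: "(\<lambda>n. f_star_n k n / n) \<longlonglongrightarrow> L"
    and low: "\<And>n. k \<le> n \<Longrightarrow> (f_star_n k n - 1) / n \<le> L"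
  proof (rule almost_superadditive_ratio_converges[of k "f_star_n k" "1 / sqrt (real k - 1)"])
    show "f_star_n k n \<le> f_star_n k m" if "k \<le> n" "n \<le> m" for n m
      using f_star_n_mono[OF k1(1) that] .
    show "real t * f_star_n k n - real t \<le> f_star_n k (t * n)" if "k \<le> n" "t > 0" for n t
      using f_star_n_blowup[OF k1(1) that] .
    show "f_star_n k n \<le> 1 / sqrt (real k - 1) * n" if "k \<le> n" for n
      using f_star_n_le[OF k that] by simp
  qed (use k1 in auto)
  have fL: "f_star k = L" unfolding f_star_def using L by (rule limI)
  have "eventually (\<lambda>n. f_star_n k n / n \<le> 1 / sqrt (real k - 1)) sequentially"
    using eventually_ge_at_top[of k]
  proof eventually_elim
    case (elim n)
    then show ?case using f_star_n_le[OF k elim] k by (simp add: field_simps)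
  qed
  then show "f_star k \<le> 1 / sqrt (real k - 1)"
    unfolding fL using L by (intro tendsto_upperbound) auto
  assume s: "s > 0" "k \<le> s\<^sup>2 + 1"
  have "eventually (\<lambda>j. 1 / real s - 2 / (s * 2 ^ j) \<le> L) sequentially"
    using eventually_ge_at_top[of "s + k"]
  proof eventually_elim
    case (elim j)
    have "k \<le> j" using elim by simp
    also have "j \<le> 2 ^ j" using less_exp[of j] by simp
    also have "\<dots> \<le> s * 2 ^ j" using s by simp
    finally have kj: "k \<le> s * 2 ^ j" .
    have "1 / real s - 2 / (s * 2 ^ j) = (2 ^ j - 1 - 1) / real (s * 2 ^ j)"
      using s by (simp add: field_simps)
    also have "\<dots> \<le> (f_star_n k (s * 2 ^ j) - 1) / real (s * 2 ^ j)"
      using f_star_n_kharaghani_ge[of s j k] s k1 kj elim by (intro divide_right_mono) auto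
    also have "\<dots> \<le> L" using low[OF kj] .
    finally show ?case .
  qed
  moreover have "(\<lambda>j. 1 / real s - 2 / (s * 2 ^ j)) \<longlonglongrightarrow> 1 / real s"
    using s by real_asymp
  ultimately show "1 / real s \<le> f_star k"
    unfolding fL by (intro tendsto_upperbound) auto
qed

theorem theorem3p5:
  shows "(\<forall>k::nat. k \<ge> 2 \<longrightarrow>
            1 / sqrt (real k - 1) \<ge> f_star k \<and>
            f_star k > 1 / (sqrt (real k - 1) + 1)) \<and>
         (\<lambda>k::nat. 1 / (sqrt (real k - 1) + 1) - 1 / sqrt (real k - 1))
            \<in> O[at_top](\<lambda>k. 1 / real k)"
proof (intro conjI allI impI)
  fix k :: nat assume k: "k \<ge> 2"
  show "f_star k \<le> 1 / sqrt (real k - 1)" by (rule f_star_bounds(1)[OF k])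
  define x where "x = sqrt (real k - 1)"
  have x: "x \<ge> 1" "x\<^sup>2 = real k - 1" using k by (auto simp: x_def)
  \<comment> \<open>the least admissible \<open>s\<close>; rounding up costs less than 1, whence the strict inequality\<close>
  define s where "s = nat \<lceil>x\<rceil>"
  have s: "x \<le> s" "real s < x + 1" "s > 0" using x by (auto simp: s_def) linarith+
  have "x\<^sup>2 \<le> (real s)\<^sup>2" using s x by (intro power_mono) auto
  then have "real k \<le> real (s\<^sup>2 + 1)" using x by simp
  then have "k \<le> s\<^sup>2 + 1" by (simp only: of_nat_le_iff)
  then have "1 / real s \<le> f_star k" by (rule f_star_bounds(2)[OF k s(3)])
  moreover have "1 / (x + 1) < 1 / real s" using s x by (intro divide_strict_left_mono) auto
  ultimately show "1 / (sqrt (real k - 1) + 1) < f_star k" by (simp add: x_def)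
next
  show "(\<lambda>k::nat. 1 / (sqrt (real k - 1) + 1) - 1 / sqrt (real k - 1)) \<in> O[at_top](\<lambda>k. 1 / real k)"
    by real_asymp
qed

end
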